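(* Let $R$ be a finite commutative ring with Jacobson radical $\mathcal{J}$, let $I\subseteq\mathcal{J}$ be an ideal, let $n\ge1$, and let $K$ be a field of characteristic zero. Then the natural map induces an isomorphism of $\mathrm{GL}_n(R)$-representations $$\mathrm{St}^K_n(R)^{\Gamma_n(I)}\cong\mathrm{St}^K_n(R/I).$$
   Context: A flag in $R^n$ is a chain $0\subsetneq V_1\subsetneq\cdots\subsetneq V_k\subsetneq R^n$ of free direct summands; complete if $k=n-1$, good if it is a subflag of a complete flag. The Tits complex $\mathcal{T}_n(R)$ has as vertices the direct summands $V$ of $R^n$, $0\ne V\ne R^n$, with $V$ and $R^n/V$ free, and a $k$-simplex for every good flag with $k+1$ terms; $\mathrm{GL}_n(R)$ acts on it. $\mathrm{St}^K_n(R)=\tilde H_{n-2}(\mathcal{T}_n(R);K)$, a $\mathrm{GL}_n(R)$-representation. The map $R\to R/I$ induces (via $V\mapsto V\otimes_R R/I$) an equivariant simplicial map $\mathcal{T}_n(R)\to\mathcal{T}_n(R/I)$, hence $\mathrm{St}^K_n(R)\to \mathrm{St}^K_n(R/I)$, where $\mathrm{GL}_n(R)$ acts on the target through $\mathrm{GL}_n(R)\to\mathrm{GL}_n(R/I)$. $\Gamma_n(I)=\ker(\mathrm{GL}_n(R)\to\mathrm{GL}_n(R/I))$, and $(\cdot)^{\Gamma_n(I)}$ denotes invariants. *)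

theory Defs
  imports "HOL-Algebra.QuotRing" "HOL-Library.Sublist"
begin

definition jacobson_radical :: "('a,'m) ring_scheme \<Rightarrow> 'a set" where
  "jacobson_radical R = {x \<in> carrier R. \<forall>M. maximalideal M R \<longrightarrow> x \<in> M}"

definition vecs :: "('a,'m) ring_scheme \<Rightarrow> nat \<Rightarrow> (nat \<Rightarrow> 'a) set" where
  "vecs R n = {v. (\<forall>i<n. v i \<in> carrier R) \<and> (\<forall>i. n \<le> i \<longrightarrow> v i = zero R)}"

definition vzero :: "('a,'m) ring_scheme \<Rightarrow> nat \<Rightarrow> 'a" where
  "vzero R = (\<lambda>i. zero R)"

definition vadd :: "('a,'m) ring_scheme \<Rightarrow> nat \<Rightarrow> (nat \<Rightarrow> 'a) \<Rightarrow> (nat \<Rightarrow> 'a) \<Rightarrow> nat \<Rightarrow> 'a" where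
  "vadd R n v w = (\<lambda>i. if i < n then add R (v i) (w i) else zero R)"

definition vsmult :: "('a,'m) ring_scheme \<Rightarrow> nat \<Rightarrow> 'a \<Rightarrow> (nat \<Rightarrow> 'a) \<Rightarrow> nat \<Rightarrow> 'a" where
  "vsmult R n a v = (\<lambda>i. if i < n then mult R a (v i) else zero R)"

definition lincomb :: "('a,'m) ring_scheme \<Rightarrow> nat \<Rightarrow> 'a list \<Rightarrow> (nat \<Rightarrow> 'a) list \<Rightarrow> nat \<Rightarrow> 'a" where
  "lincomb R n cs bs = foldr (\<lambda>(c, b) acc. vadd R n (vsmult R n c b) acc) (zip cs bs) (vzero R)"

definition submod :: "('a,'m) ring_scheme \<Rightarrow> nat \<Rightarrow> (nat \<Rightarrow> 'a) set \<Rightarrow> bool" where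
  "submod R n V \<longleftrightarrow> V \<subseteq> vecs R n \<and> vzero R \<in> V \<and>
     (\<forall>v\<in>V. \<forall>w\<in>V. vadd R n v w \<in> V) \<and> (\<forall>a\<in>carrier R. \<forall>v\<in>V. vsmult R n a v \<in> V)"

definition free_submod :: "('a,'m) ring_scheme \<Rightarrow> nat \<Rightarrow> (nat \<Rightarrow> 'a) set \<Rightarrow> bool" where
  "free_submod R n V \<longleftrightarrow> submod R n V \<and>
     (\<exists>bs. set bs \<subseteq> V \<and>
        (\<forall>v\<in>V. \<exists>!cs. length cs = length bs \<and> set cs \<subseteq> carrier R \<and> lincomb R n cs bs = v))"

definition free_quotient :: "('a,'m) ring_scheme \<Rightarrow> nat \<Rightarrow> (nat \<Rightarrow> 'a) set \<Rightarrow> bool" where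
  "free_quotient R n V \<longleftrightarrow> submod R n V \<and>
     (\<exists>ws. set ws \<subseteq> vecs R n \<and>
        (\<forall>x\<in>vecs R n. \<exists>!cs. length cs = length ws \<and> set cs \<subseteq> carrier R \<and>
                         (\<exists>v\<in>V. x = vadd R n v (lincomb R n cs ws))))"

definition direct_summand :: "('a,'m) ring_scheme \<Rightarrow> nat \<Rightarrow> (nat \<Rightarrow> 'a) set \<Rightarrow> bool" where
  "direct_summand R n V \<longleftrightarrow> submod R n V \<and>
     (\<exists>W. submod R n W \<and> (\<forall>x\<in>vecs R n. \<exists>!p. fst p \<in> V \<and> snd p \<in> W \<and> x = vadd R n (fst p) (snd p)))"

definition tits_vertex :: "('a,'m) ring_scheme \<Rightarrow> nat \<Rightarrow> (nat \<Rightarrow> 'a) set \<Rightarrow> bool" where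
  "tits_vertex R n V \<longleftrightarrow> direct_summand R n V \<and> free_submod R n V \<and> free_quotient R n V \<and>
     V \<noteq> {vzero R} \<and> V \<noteq> vecs R n"

definition flag :: "('a,'m) ring_scheme \<Rightarrow> nat \<Rightarrow> (nat \<Rightarrow> 'a) set list \<Rightarrow> bool" where
  "flag R n F \<longleftrightarrow> sorted_wrt (\<subset>) F \<and>
     (\<forall>V\<in>set F. direct_summand R n V \<and> free_submod R n V \<and> V \<noteq> {vzero R} \<and> V \<noteq> vecs R n)"

definition complete_flag :: "('a,'m) ring_scheme \<Rightarrow> nat \<Rightarrow> (nat \<Rightarrow> 'a) set list \<Rightarrow> bool" where
  "complete_flag R n F \<longleftrightarrow> flag R n F \<and> length F = n - 1"

definition good_flag :: "('a,'m) ring_scheme \<Rightarrow> nat \<Rightarrow> (nat \<Rightarrow> 'a) set list \<Rightarrow> bool" where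
  "good_flag R n F \<longleftrightarrow> flag R n F \<and> (\<exists>G. complete_flag R n G \<and> subseq F G)"

text \<open>Simplices with l vertices (i.e. of dimension l-1), l = 0 giving the empty simplex
  of the augmented (reduced) chain complex. Simplices are oriented by the inclusion order.\<close>
definition simplices :: "('a,'m) ring_scheme \<Rightarrow> nat \<Rightarrow> nat \<Rightarrow> (nat \<Rightarrow> 'a) set list set" where
  "simplices R n l = {F. length F = l \<and> (F = [] \<or> (good_flag R n F \<and> (\<forall>V\<in>set F. tits_vertex R n V)))}"

definition chains :: "('a,'m) ring_scheme \<Rightarrow> nat \<Rightarrow> nat \<Rightarrow> ((nat \<Rightarrow> 'a) set list \<Rightarrow> 'k::field) set" where
  "chains R n l = {c. \<forall>F. F \<notin> simplices R n l \<longrightarrow> c F = 0}"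

definition del_at :: "nat \<Rightarrow> 'b list \<Rightarrow> 'b list" where
  "del_at i xs = take i xs @ drop (Suc i) xs"

definition boundary :: "('a,'m) ring_scheme \<Rightarrow> nat \<Rightarrow> nat \<Rightarrow>
     ((nat \<Rightarrow> 'a) set list \<Rightarrow> 'k::field) \<Rightarrow> (nat \<Rightarrow> 'a) set list \<Rightarrow> 'k" where
  "boundary R n l c = (\<lambda>H. if H \<in> simplices R n (l - 1) then
      (\<Sum>G\<in>simplices R n l. \<Sum>i<l. if del_at i G = H then (-1) ^ i * c G else 0) else 0)"

text \<open>Reduced homology in the (l-1)-st degree when there are no simplices with l+1 vertices
  (the top degree): the cycles. Degree -1 (l = 0) has zero target.\<close>
definition top_cycles :: "('a,'m) ring_scheme \<Rightarrow> nat \<Rightarrow> nat \<Rightarrow> ((nat \<Rightarrow> 'a) set list \<Rightarrow> 'k::field) set" where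
  "top_cycles R n l = {c \<in> chains R n l. l = 0 \<or> boundary R n l c = (\<lambda>H. 0)}"

text \<open>Steinberg module St_n^K(R) = reduced H_{n-2} of the Tits complex. Since good flags
  have at most n-1 terms, there are no (n-1)-simplices, so H_{n-2} equals the cycle space.\<close>
definition steinberg :: "('a,'m) ring_scheme \<Rightarrow> nat \<Rightarrow> ((nat \<Rightarrow> 'a) set list \<Rightarrow> 'k::field) set" where
  "steinberg R n = top_cycles R n (n - 1)"

definition mat_mul :: "('a,'m) ring_scheme \<Rightarrow> nat \<Rightarrow> (nat \<Rightarrow> nat \<Rightarrow> 'a) \<Rightarrow> (nat \<Rightarrow> nat \<Rightarrow> 'a) \<Rightarrow> nat \<Rightarrow> nat \<Rightarrow> 'a" where
  "mat_mul R n g h = (\<lambda>i j. if i < n \<and> j < n then finsum R (\<lambda>k. mult R (g i k) (h k j)) {..<n} else zero R)"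

definition mat_one :: "('a,'m) ring_scheme \<Rightarrow> nat \<Rightarrow> nat \<Rightarrow> nat \<Rightarrow> 'a" where
  "mat_one R n = (\<lambda>i j. if i < n \<and> j < n \<and> i = j then one R else zero R)"

definition mats :: "('a,'m) ring_scheme \<Rightarrow> nat \<Rightarrow> (nat \<Rightarrow> nat \<Rightarrow> 'a) set" where
  "mats R n = {g. (\<forall>i<n. \<forall>j<n. g i j \<in> carrier R) \<and> (\<forall>i j. \<not> (i < n \<and> j < n) \<longrightarrow> g i j = zero R)}"

definition GL :: "('a,'m) ring_scheme \<Rightarrow> nat \<Rightarrow> (nat \<Rightarrow> nat \<Rightarrow> 'a) set" where
  "GL R n = {g \<in> mats R n. \<exists>h\<in>mats R n. mat_mul R n g h = mat_one R n \<and> mat_mul R n h g = mat_one R n}"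

definition mat_vec :: "('a,'m) ring_scheme \<Rightarrow> nat \<Rightarrow> (nat \<Rightarrow> nat \<Rightarrow> 'a) \<Rightarrow> (nat \<Rightarrow> 'a) \<Rightarrow> nat \<Rightarrow> 'a" where
  "mat_vec R n g v = (\<lambda>i. if i < n then finsum R (\<lambda>j. mult R (g i j) (v j)) {..<n} else zero R)"

definition act_flag :: "('a,'m) ring_scheme \<Rightarrow> nat \<Rightarrow> (nat \<Rightarrow> nat \<Rightarrow> 'a) \<Rightarrow>
     (nat \<Rightarrow> 'a) set list \<Rightarrow> (nat \<Rightarrow> 'a) set list" where
  "act_flag R n g F = map (\<lambda>V. mat_vec R n g ` V) F"

definition act_chain :: "('a,'m) ring_scheme \<Rightarrow> nat \<Rightarrow> nat \<Rightarrow> (nat \<Rightarrow> nat \<Rightarrow> 'a) \<Rightarrow>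
     ((nat \<Rightarrow> 'a) set list \<Rightarrow> 'k::field) \<Rightarrow> (nat \<Rightarrow> 'a) set list \<Rightarrow> 'k" where
  "act_chain R n l g c = (\<lambda>F. if F \<in> simplices R n l then
      (\<Sum>G\<in>simplices R n l. if act_flag R n g G = F then c G else 0) else 0)"

definition act_st :: "('a,'m) ring_scheme \<Rightarrow> nat \<Rightarrow> (nat \<Rightarrow> nat \<Rightarrow> 'a) \<Rightarrow>
     ((nat \<Rightarrow> 'a) set list \<Rightarrow> 'k::field) \<Rightarrow> (nat \<Rightarrow> 'a) set list \<Rightarrow> 'k" where
  "act_st R n g c = act_chain R n (n - 1) g c"

definition congruence_subgroup :: "('a,'m) ring_scheme \<Rightarrow> 'a set \<Rightarrow> nat \<Rightarrow> (nat \<Rightarrow> nat \<Rightarrow> 'a) set" where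
  "congruence_subgroup R I n = {g \<in> GL R n. \<forall>i<n. \<forall>j<n. a_minus R (g i j) (mat_one R n i j) \<in> I}"

definition invariants :: "('a,'m) ring_scheme \<Rightarrow> nat \<Rightarrow> (nat \<Rightarrow> nat \<Rightarrow> 'a) set \<Rightarrow>
     ((nat \<Rightarrow> 'a) set list \<Rightarrow> 'k::field) set \<Rightarrow> ((nat \<Rightarrow> 'a) set list \<Rightarrow> 'k) set" where
  "invariants R n H M = {c \<in> M. \<forall>g\<in>H. act_st R n g c = c}"

definition red_vec :: "('a,'m) ring_scheme \<Rightarrow> 'a set \<Rightarrow> (nat \<Rightarrow> 'a) \<Rightarrow> nat \<Rightarrow> 'a set" where
  "red_vec R I v = (\<lambda>i. a_r_coset R I (v i))"

definition red_mat :: "('a,'m) ring_scheme \<Rightarrow> 'a set \<Rightarrow> (nat \<Rightarrow> nat \<Rightarrow> 'a) \<Rightarrow> nat \<Rightarrow> nat \<Rightarrow> 'a set" where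
  "red_mat R I g = (\<lambda>i j. a_r_coset R I (g i j))"

text \<open>V |-> V \<otimes>_R R/I, realised as the image of V in (R/I)^n.\<close>
definition red_flag :: "('a,'m) ring_scheme \<Rightarrow> 'a set \<Rightarrow> (nat \<Rightarrow> 'a) set list \<Rightarrow> (nat \<Rightarrow> 'a set) set list" where
  "red_flag R I F = map (\<lambda>V. red_vec R I ` V) F"

definition st_map :: "('a,'m) ring_scheme \<Rightarrow> 'a set \<Rightarrow> nat \<Rightarrow>
     ((nat \<Rightarrow> 'a) set list \<Rightarrow> 'k::field) \<Rightarrow> (nat \<Rightarrow> 'a set) set list \<Rightarrow> 'k" where
  "st_map R I n c = (\<lambda>F. if F \<in> simplices (R Quot I) n (n - 1) then
      (\<Sum>G\<in>simplices R n (n - 1). if red_flag R I G = F then c G else 0) else 0)"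

end

theory Submission
  imports Defs
begin

text \<open>
  Over a finite commutative ring (stable range one) a unimodular column can be completed to an
  invertible matrix, so the good flags are exactly the \<open>GL\<^sub>n(R)\<close>-translates of the subflags of the
  standard flag \<open>R\<^sup>1 \<subset> \<dots> \<subset> R\<^sup>n\<^sup>-\<^sup>1\<close>. By Nakayama's lemma every lift of an invertible matrix over \<open>R/I\<close> is
  invertible, and a block triangular matrix has a block triangular lift. Hence reduction is onto on
  simplices of each dimension, and its fibres are the orbits of \<open>\<Gamma>\<^sub>n(I)\<close>. In characteristic zero
  pushing forward along such a quotient map is an isomorphism from invariant chains to chains in
  every degree, compatible with the boundary, hence an isomorphism on top cycles.
\<close>

section \<open>Push-forward of finitely supported functions\<close>

text \<open>Faces, group action and reduction all act on chains through \<open>push\<close>, so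
  identities between chain maps become identities between maps on flags. Flags are handled entirely
  through matrices and counting. A free submodule of R^n is the image of a linear injection of some
  R^r, so over a finite ring its rank is read off from its cardinality, and an endomorphism of R^n
  is invertible as soon as it is injective. Counting says nothing over the zero ring, which is
  therefore treated apart. The delicate point is the description of the fibres of reduction. Two
  flags with equal reductions are given by matrices \<open>g\<close> and \<open>g'\<close> that need
  not be congruent modulo \<open>I\<close>, because a flag fixes its matrix only up to a stabiliser.
  The discrepancy lives in a stabiliser over the quotient and must be lifted into the stabiliser
  over \<open>R\<close>; this dictates a lift that sends zero entries to zero.\<close>

definition push :: "'x set \<Rightarrow> ('x \<Rightarrow> 'y) \<Rightarrow> 'y set \<Rightarrow> ('x \<Rightarrow> 'k::comm_ring_1) \<Rightarrow> 'y \<Rightarrow> 'k" where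
  "push X f Y c = (\<lambda>F. if F \<in> Y then \<Sum>G\<in>X. if f G = F then c G else 0 else 0)"

lemma push_cong:
  assumes "\<And>G. G \<in> X \<Longrightarrow> f G = f' G" "\<And>G. G \<in> X \<Longrightarrow> c G = c' G"
  shows "push X f Y c = push X f' Y c'"
  unfolding push_def using assms by (intro ext if_cong sum.cong refl) auto

text \<open>Interchanging the two sums leaves, for each \<open>G\<close>, only the term
  \<open>F = f G\<close>, which is present because \<open>f\<close> maps \<open>X\<close> into
  \<open>Y\<close>.\<close>

lemma push_push:
  assumes fin: "finite X" "finite Y" and f: "f ` X \<subseteq> Y"
  shows "push Y g Z (push X f Y c) = push X (g \<circ> f) Z c"
proof
  fix H
  have "(\<Sum>F\<in>Y. if g F = H then \<Sum>G\<in>X. if f G = F then c G else 0 else 0)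
      = (\<Sum>F\<in>Y. \<Sum>G\<in>X. if f G = F then (if g F = H then c G else 0) else 0)"
    by (intro sum.cong refl) (simp add: if_distrib cong: if_cong)
  also have "\<dots> = (\<Sum>G\<in>X. \<Sum>F\<in>Y. if f G = F then (if g F = H then c G else 0) else 0)"
    by (rule sum.swap)
  also have "\<dots> = (\<Sum>G\<in>X. if g (f G) = H then c G else 0)"
    using fin f by (intro sum.cong refl) (subst sum.delta', auto)
  finally have "(\<Sum>F\<in>Y. if g F = H then push X f Y c F else 0) = (\<Sum>G\<in>X. if g (f G) = H then c G else 0)"
    by (simp add: push_def cong: if_cong sum.cong)
  then show "push Y g Z (push X f Y c) H = push X (g \<circ> f) Z c H"
    unfolding push_def[of Y g] push_def[of X "g \<circ> f"] by simp
qed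

lemma push_sum_scale:
  "push X f Y (\<lambda>G. \<Sum>i\<in>A. s i * c i G) = (\<lambda>F. \<Sum>i\<in>A. s i * push X f Y (c i) F)"
proof
  fix F
  have "(\<Sum>G\<in>X. if f G = F then \<Sum>i\<in>A. s i * c i G else 0)
      = (\<Sum>G\<in>X. \<Sum>i\<in>A. s i * (if f G = F then c i G else 0))"
    by (intro sum.cong refl) auto
  also have "\<dots> = (\<Sum>i\<in>A. \<Sum>G\<in>X. s i * (if f G = F then c i G else 0))"
    by (rule sum.swap)
  finally show "push X f Y (\<lambda>G. \<Sum>i\<in>A. s i * c i G) F = (\<Sum>i\<in>A. s i * push X f Y (c i) F)"
    by (simp add: push_def sum_distrib_left)
qed

lemma push_diff: "push X f Y (\<lambda>G. c G - d G) = (\<lambda>F. push X f Y c F - push X f Y d F)"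
  unfolding push_def by (intro ext) (auto simp: sum_subtractf[symmetric] intro!: sum.cong)

text \<open>By injectivity \<open>G\<close> is the only source of \<open>a G\<close>. Hence a chain
  fixed by \<open>push X a X\<close> has equal values at \<open>G\<close> and \<open>a G\<close>:
  invariance is constancy along orbits.\<close>

lemma push_bij_betw:
  assumes "finite X" "bij_betw a X X" "G \<in> X"
  shows "push X a X c (a G) = c G"
proof -
  have "a G \<in> X" using assms by (auto simp: bij_betw_def)
  moreover have "(\<Sum>G'\<in>X. if a G' = a G then c G' else 0) = (\<Sum>G'\<in>X. if G' = G then c G' else 0)"
    using assms by (intro sum.cong refl) (auto simp: bij_betw_def inj_on_def)
  ultimately show ?thesis
    using assms by (simp add: push_def)
qed

text \<open>On chains constant on fibres the push-forward merely multiplies by the fibre size, a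
  factor that can be divided out when lifting.\<close>

lemma push_const_on_fibre:
  fixes c :: "'x \<Rightarrow> 'k::field_char_0"
  assumes "finite X" "G \<in> X" "f ` X \<subseteq> Y"
    and const: "\<And>G'. G' \<in> X \<Longrightarrow> f G' = f G \<Longrightarrow> c G' = c G"
  shows "push X f Y c (f G) = of_nat (card {G'\<in>X. f G' = f G}) * c G"
proof -
  have "(\<Sum>G'\<in>X. if f G' = f G then c G' else 0) = (\<Sum>G'\<in>{G'\<in>X. f G' = f G}. c G')"
    using assms(1) by (simp add: sum.inter_filter)
  also have "\<dots> = (\<Sum>G'\<in>{G'\<in>X. f G' = f G}. c G)"
    by (intro sum.cong refl const) auto
  finally show ?thesis using assms(1-3) by (auto simp: push_def)
qed

text \<open>Characteristic zero enters here: a fibre size is a positive integer and so is invertible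
  in the field.\<close>

lemma card_fibre_nonzero:
  assumes "finite X" "G \<in> X"
  shows "of_nat (card {G'\<in>X. f G' = f G}) \<noteq> (0::'k::field_char_0)"
  using assms by (auto simp: card_eq_0_iff)

text \<open>Injectivity in kernel form, which applies to a difference of two chains as well as to
  the boundary of a lifted chain.\<close>

lemma push_eq_0_imp_eq_0:
  fixes c :: "'x \<Rightarrow> 'k::field_char_0"
  assumes "finite X" "f ` X \<subseteq> Y" "\<And>G. G \<notin> X \<Longrightarrow> c G = 0"
    and const: "\<And>G G'. G \<in> X \<Longrightarrow> G' \<in> X \<Longrightarrow> f G' = f G \<Longrightarrow> c G' = c G"
    and zero: "push X f Y c = (\<lambda>F. 0)"
  shows "c = (\<lambda>G. 0)"
proof
  fix G
  show "c G = 0"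
  proof (cases "G \<in> X")
    case True
    have "of_nat (card {G'\<in>X. f G' = f G}) * c G = 0"
      using push_const_on_fibre[OF assms(1) True assms(2), of c] const[OF True] zero
      by (metis (no_types, lifting))
    with card_fibre_nonzero[OF assms(1) True, of f, where 'k='k] show ?thesis by simp
  qed (use assms(3) in auto)
qed

section \<open>The simplicial boundary as a signed sum of push-forwards\<close>

definition bdry :: "(nat \<Rightarrow> 'v list set) \<Rightarrow> nat \<Rightarrow> ('v list \<Rightarrow> 'k::comm_ring_1) \<Rightarrow> 'v list \<Rightarrow> 'k" where
  "bdry X l c = (\<lambda>H. \<Sum>i<l. (-1) ^ i * push (X l) (del_at i) (X (l - 1)) c H)"

lemma boundary_eq_bdry: "boundary R n l c = bdry (simplices R n) l c"
proof
  fix H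
  have "(\<Sum>G\<in>simplices R n l. \<Sum>i<l. if del_at i G = H then (-1) ^ i * c G else 0)
      = (\<Sum>i<l. \<Sum>G\<in>simplices R n l. (-1) ^ i * (if del_at i G = H then c G else 0))"
    by (subst sum.swap, intro sum.cong refl) auto
  then show "boundary R n l c H = bdry (simplices R n) l c H"
    by (simp add: boundary_def bdry_def push_def sum_distrib_left)
qed

text \<open>By \<open>push_push\<close> both sides are, face by face, push-forwards of
  \<open>c\<close> along one composite map, and the two composites agree because \<open>f\<close>
  commutes with deleting an entry. Serves both the reduction map and the action of a group
  element.\<close>

lemma bdry_push:
  assumes "\<And>l. finite (X l)" "\<And>l. finite (Y l)" "\<And>l. f ` X l \<subseteq> Y l"
    and faces: "\<And>i G. i < l \<Longrightarrow> G \<in> X l \<Longrightarrow> del_at i G \<in> X (l - 1)"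
               "\<And>i G. i < l \<Longrightarrow> G \<in> Y l \<Longrightarrow> del_at i G \<in> Y (l - 1)"
    and comm: "\<And>i G. i < l \<Longrightarrow> G \<in> X l \<Longrightarrow> f (del_at i G) = del_at i (f G)"
  shows "bdry Y l (push (X l) f (Y l) c) = push (X (l - 1)) f (Y (l - 1)) (bdry X l c)"
proof -
  have "push (Y l) (del_at i) (Y (l - 1)) (push (X l) f (Y l) c)
      = push (X (l - 1)) f (Y (l - 1)) (push (X l) (del_at i) (X (l - 1)) c)" if "i < l" for i
  proof -
    have 1: "push (Y l) (del_at i) (Y (l - 1)) (push (X l) f (Y l) c) = push (X l) (del_at i \<circ> f) (Y (l - 1)) c"
      by (rule push_push) (use assms(1-3) in auto)
    have 2: "push (X (l - 1)) f (Y (l - 1)) (push (X l) (del_at i) (X (l - 1)) c) = push (X l) (f \<circ> del_at i) (Y (l - 1)) c"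
      by (rule push_push) (use assms(1-3) faces(1) that in auto)
    show ?thesis unfolding 1 2 by (rule push_cong) (use comm that in auto)
  qed
  then show ?thesis
    unfolding bdry_def push_sum_scale by (intro ext sum.cong) auto
qed

text \<open>Averaging over the fibres inverts the push-forward on invariant chains, in every degree;
  applied one degree down it shows that the lift of a cycle is a cycle.\<close>

theorem push_bij_betw_invariant_cycles:
  fixes X :: "nat \<Rightarrow> 'v list set" and Y :: "nat \<Rightarrow> 'w list set"
  assumes fin: "\<And>l. finite (X l)" "\<And>l. finite (Y l)" and surj: "\<And>l. f ` X l = Y l"
    and faces: "\<And>l i G. i < l \<Longrightarrow> G \<in> X l \<Longrightarrow> del_at i G \<in> X (l - 1)"
               "\<And>l i G. i < l \<Longrightarrow> G \<in> Y l \<Longrightarrow> del_at i G \<in> Y (l - 1)"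
    and comm: "\<And>l i G. i < l \<Longrightarrow> G \<in> X l \<Longrightarrow> f (del_at i G) = del_at i (f G)"
    and bij: "\<And>l a. a \<in> A \<Longrightarrow> bij_betw a (X l) (X l)"
    and acomm: "\<And>l i G a. i < l \<Longrightarrow> G \<in> X l \<Longrightarrow> a \<in> A \<Longrightarrow> a (del_at i G) = del_at i (a G)"
    and fibre: "\<And>l G G'. G \<in> X l \<Longrightarrow> G' \<in> X l \<Longrightarrow> f G' = f G \<longleftrightarrow> (\<exists>a\<in>A. G' = a G)"
  shows "bij_betw (push (X l) f (Y l))
    {c :: 'v list \<Rightarrow> 'k::field_char_0. (\<forall>G. G \<notin> X l \<longrightarrow> c G = 0) \<and> (l = 0 \<or> bdry X l c = (\<lambda>H. 0))
       \<and> (\<forall>a\<in>A. push (X l) a (X l) c = c)}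
    {z. (\<forall>G. G \<notin> Y l \<longrightarrow> z G = 0) \<and> (l = 0 \<or> bdry Y l z = (\<lambda>H. 0))}" (is "bij_betw ?p ?C ?Z")
proof -
  have sub: "f ` X l \<subseteq> Y l" for l using surj by simp
  \<comment> \<open>The fibres of \<open>f\<close> are the orbits under \<open>A\<close>, so
    invariance yields constancy on fibres.\<close>
  have const: "c G' = c G"
    if inv: "\<forall>a\<in>A. push (X l) a (X l) c = c" and G: "G \<in> X l" "G' \<in> X l" "f G' = f G"
    for c :: "'v list \<Rightarrow> 'k" and G G' l
  proof -
    obtain a where "a \<in> A" "G' = a G" using fibre G by blast
    then show ?thesis using push_bij_betw[OF fin(1) bij[OF \<open>a \<in> A\<close>] G(1), of c] inv by simp
  qed
  \<comment> \<open>Stated for every \<open>l\<close>: degree \<open>l\<close> gives injectivity,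
    degree \<open>l - 1\<close> is applied to the boundary of a lift.\<close>
  have inj0: "c = (\<lambda>G. 0)"
    if "\<forall>a\<in>A. push (X l) a (X l) c = c" "\<And>G. G \<notin> X l \<Longrightarrow> c G = 0" "push (X l) f (Y l) c = (\<lambda>F. 0)"
    for c :: "'v list \<Rightarrow> 'k" and l
    by (rule push_eq_0_imp_eq_0[OF fin(1) sub that(2) _ that(3)]) (assumption, rule const[OF that(1)])
  have comm_f: "bdry Y l (push (X l) f (Y l) c) = push (X (l - 1)) f (Y (l - 1)) (bdry X l c)"
    for c :: "'v list \<Rightarrow> 'k"
    by (rule bdry_push) (use fin sub faces comm in auto)
  have comm_a: "bdry X l (push (X l) a (X l) c) = push (X (l - 1)) a (X (l - 1)) (bdry X l c)"
    if "a \<in> A" for c :: "'v list \<Rightarrow> 'k" and a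
    by (rule bdry_push) (use fin faces acomm that bij in \<open>auto simp: bij_betw_def\<close>)
  show ?thesis
  proof (rule bij_betwI')
    fix c d :: "'v list \<Rightarrow> 'k" assume cd: "c \<in> ?C" "d \<in> ?C"
    show "?p c = ?p d \<longleftrightarrow> c = d"
    proof
      assume eq: "?p c = ?p d"
      have 1: "push (X l) a (X l) (\<lambda>G. c G - d G) = (\<lambda>G. c G - d G)" if "a \<in> A" for a
        using cd that by (simp add: push_diff)
      have 2: "push (X l) f (Y l) (\<lambda>G. c G - d G) = (\<lambda>F. 0)"
        using eq by (simp add: push_diff)
      have "(\<lambda>G. c G - d G) = (\<lambda>G. 0)"
        using inj0[of l "\<lambda>G. c G - d G"] 1 2 cd by auto
      then show "c = d" by (simp add: fun_eq_iff)
    qed auto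
  next
    fix c :: "'v list \<Rightarrow> 'k" assume c: "c \<in> ?C"
    have "push X' h Y' (\<lambda>G. 0) = (\<lambda>F. 0::'k)" for X' :: "'v list set" and h :: "'v list \<Rightarrow> 'w list" and Y'
      by (auto simp: push_def)
    then have "bdry Y l (?p c) = (\<lambda>H. 0)" if "l \<noteq> 0"
      using c that unfolding comm_f by auto
    then show "?p c \<in> ?Z" by (auto simp: push_def)
  next
    fix z :: "'w list \<Rightarrow> 'k" assume z: "z \<in> ?Z"
    \<comment> \<open>Spreads each value of \<open>z\<close> evenly over the fibre above it. On
      \<open>X l\<close> the value depends on \<open>f G\<close> alone, which makes \<open>c\<close>
      invariant, and the push-forward multiplies by the fibre size again.\<close>
    define c where "c G = (if G \<in> X l then z (f G) / of_nat (card {G'\<in>X l. f G' = f G}) else 0)" for G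
    have pc: "?p c = z"
    proof
      fix F
      show "?p c F = z F"
      proof (cases "F \<in> Y l")
        case True
        then obtain G where G: "G \<in> X l" "F = f G" using surj by blast
        have "?p c (f G) = of_nat (card {G'\<in>X l. f G' = f G}) * c G"
          by (rule push_const_on_fibre[OF fin(1) G(1) sub]) (auto simp: c_def G)
        also have "\<dots> = z (f G)"
          using card_fibre_nonzero[OF fin(1) G(1), of f, where 'k='k] G by (simp add: c_def)
        finally show ?thesis using G by simp
      next
        case False
        then show ?thesis using z by (simp add: push_def)
      qed
    qed
    have inv: "push (X l) a (X l) c = c" if aA: "a \<in> A" for a
    proof
      fix G
      show "push (X l) a (X l) c G = c G"
      proof (cases "G \<in> X l")
        case True
        then obtain G0 where G0: "G0 \<in> X l" "G = a G0"
          using bij[OF aA, of l] by (auto simp: bij_betw_def)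
        then have "f G = f G0" using fibre[OF G0(1) True] aA by blast
        then show ?thesis using push_bij_betw[OF fin(1) bij[OF aA] G0(1), of c] G0 True
          by (simp add: c_def)
      qed (auto simp: push_def c_def)
    qed
    \<comment> \<open>The boundary of \<open>c\<close> is not computed. It is invariant and pushes
      forward to the boundary of \<open>z\<close>, which is zero, so \<open>inj0\<close> one degree
      lower applies.\<close>
    have "bdry X l c = (\<lambda>H. 0)" if "l \<noteq> 0"
    proof (rule inj0)
      show "\<forall>a\<in>A. push (X (l - 1)) a (X (l - 1)) (bdry X l c) = bdry X l c"
        using comm_a[of _ c] inv by simp
      show "push (X (l - 1)) f (Y (l - 1)) (bdry X l c) = (\<lambda>F. 0)"
        using comm_f[of c] pc z that by auto
    qed (auto simp: bdry_def push_def)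
    then have "c \<in> ?C" using inv by (auto simp: c_def)
    then show "\<exists>c\<in>?C. z = ?p c" using pc by blast
  qed
qed

section \<open>Linear maps between coordinate modules\<close>

lemma (in abelian_monoid) finsum_lessThan_Suc:
  assumes "\<And>i. i \<le> m \<Longrightarrow> f i \<in> carrier G"
  shows "finsum G f {..<Suc m} = finsum G f {..<m} \<oplus> f m"
proof -
  have "finsum G f (insert m {..<m}) = f m \<oplus> finsum G f {..<m}"
    using assms by (intro finsum_insert) auto
  moreover have "finsum G f {..<m} \<in> carrier G" "f m \<in> carrier G"
    using assms by (auto intro!: finsum_closed)
  ultimately show ?thesis by (simp add: lessThan_Suc a_comm)
qed

lemma (in abelian_monoid) finsum_lessThan_Suc_shift:
  assumes "\<And>i. i \<le> m \<Longrightarrow> f i \<in> carrier G"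
  shows "finsum G f {..<Suc m} = f 0 \<oplus> finsum G (\<lambda>i. f (Suc i)) {..<m}"
  using assms
proof (induction m)
  case (Suc m)
  have "finsum G (\<lambda>i. f (Suc i)) {..<m} \<in> carrier G" using Suc.prems by (auto intro!: finsum_closed)
  then show ?case
    using Suc by (simp add: finsum_lessThan_Suc a_assoc)
qed (use finsum_lessThan_Suc[of 0 f] in simp)

context cring
begin

lemma eq_if_minus_eq_zero: "x \<in> carrier R \<Longrightarrow> y \<in> carrier R \<Longrightarrow> x \<ominus> y = \<zero> \<Longrightarrow> x = y"
  by (metis a_minus_def add.inv_closed minus_equality minus_minus)

text \<open>Entries beyond \<open>n\<close> are zero, so no bound on \<open>i\<close> is needed;
  this keeps later sums and ring identities free of side conditions.\<close>

lemma vecs_closed: "v \<in> vecs R n \<Longrightarrow> v i \<in> carrier R"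
  by (cases "i < n") (auto simp: vecs_def)

text \<open>Zero padding makes R^r literally a subset of R^n, so the standard flag consists of the
  sets \<open>vecs R r\<close> themselves.\<close>

lemma vecs_mono: "r \<le> n \<Longrightarrow> vecs R r \<subseteq> vecs R n"
  unfolding vecs_def by (auto, metis not_le zero_closed)

lemma vecs_add: "v \<in> vecs R n \<Longrightarrow> w \<in> vecs R n \<Longrightarrow> (\<lambda>i. v i \<oplus> w i) \<in> vecs R n"
  by (auto simp: vecs_def)

lemma vecs_smult: "a \<in> carrier R \<Longrightarrow> v \<in> vecs R n \<Longrightarrow> (\<lambda>i. a \<otimes> v i) \<in> vecs R n"
  by (auto simp: vecs_def)

lemma vecs_zero: "vzero R \<in> vecs R n"
  by (auto simp: vecs_def vzero_def)

lemma vadd_vecs: "v \<in> vecs R n \<Longrightarrow> w \<in> vecs R n \<Longrightarrow> vadd R n v w = (\<lambda>i. v i \<oplus> w i)"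
  by (auto simp: vecs_def vadd_def)

lemma vsmult_vecs: "a \<in> carrier R \<Longrightarrow> v \<in> vecs R n \<Longrightarrow> vsmult R n a v = (\<lambda>i. a \<otimes> v i)"
  by (auto simp: vecs_def vsmult_def)

text \<open>Over a nontrivial finite ring this count determines the rank; later comparisons of ranks
  all go through it.\<close>

lemma card_vecs: "card (vecs R n) = card (carrier R) ^ n"
proof -
  have "bij_betw (\<lambda>v. restrict v {..<n}) (vecs R n) ({..<n} \<rightarrow>\<^sub>E carrier R)"
  proof (rule bij_betwI[where g="\<lambda>w i. if i < n then w i else \<zero>"])
    show "(\<lambda>v. restrict v {..<n}) \<in> vecs R n \<rightarrow> {..<n} \<rightarrow>\<^sub>E carrier R"
      using vecs_closed by auto
    show "(\<lambda>w i. if i < n then w i else \<zero>) \<in> ({..<n} \<rightarrow>\<^sub>E carrier R) \<rightarrow> vecs R n"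
      by (rule funcsetI) (simp add: vecs_def PiE_iff)
    show "(\<lambda>i. if i < n then restrict v {..<n} i else \<zero>) = v" if "v \<in> vecs R n" for v
      using that by (auto simp: vecs_def)
    show "restrict (\<lambda>i. if i < n then w i else \<zero>) {..<n} = w" if "w \<in> {..<n} \<rightarrow>\<^sub>E carrier R" for w
      using that by (simp add: PiE_iff extensional_def restrict_def fun_eq_iff)
  qed
  then have "card (vecs R n) = card ({..<n} \<rightarrow>\<^sub>E carrier R)"
    by (rule bij_betw_same_card)
  then show ?thesis by (simp add: card_PiE)
qed

text \<open>Inside \<open>vecs R n\<close> the truncations built into \<open>vadd\<close> and
  \<open>vsmult\<close> have no effect, so pointwise operations can be used throughout.\<close>

lemma submod_vecs_iff:
  "submod R n V \<longleftrightarrow> V \<subseteq> vecs R n \<and> vzero R \<in> V \<and>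
     (\<forall>v\<in>V. \<forall>w\<in>V. (\<lambda>i. v i \<oplus> w i) \<in> V) \<and> (\<forall>a\<in>carrier R. \<forall>v\<in>V. (\<lambda>i. a \<otimes> v i) \<in> V)"
proof (cases "V \<subseteq> vecs R n")
  case True
  then have "vadd R n v w = (\<lambda>i. v i \<oplus> w i)" if "v \<in> V" "w \<in> V" for v w
    using that by (auto intro!: vadd_vecs)
  moreover have "vsmult R n a v = (\<lambda>i. a \<otimes> v i)" if "a \<in> carrier R" "v \<in> V" for a v
    using True that by (auto intro!: vsmult_vecs)
  ultimately show ?thesis by (simp add: submod_def)
qed (simp add: submod_def)

lemma submodD:
  assumes "submod R n V"
  shows submod_subset: "V \<subseteq> vecs R n"
    and submod_zero: "vzero R \<in> V"
    and submod_add: "v \<in> V \<Longrightarrow> w \<in> V \<Longrightarrow> (\<lambda>i. v i \<oplus> w i) \<in> V"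
    and submod_smult: "a \<in> carrier R \<Longrightarrow> v \<in> V \<Longrightarrow> (\<lambda>i. a \<otimes> v i) \<in> V"
  using assms unfolding submod_vecs_iff by simp_all

lemma submod_vecs: "r \<le> n \<Longrightarrow> submod R n (vecs R r)"
  using vecs_mono unfolding submod_vecs_iff by (auto intro: vecs_add vecs_smult vecs_zero)

definition unit_vec :: "nat \<Rightarrow> nat \<Rightarrow> 'a" where
  "unit_vec k = (\<lambda>i. if i = k then \<one> else \<zero>)"

lemma unit_vec_vecs: "k < n \<Longrightarrow> unit_vec k \<in> vecs R n"
  by (auto simp: vecs_def unit_vec_def)

text \<open>The domain may be any set of vectors, so that maps out of a member of a flag, such as
  the inverse of a parametrisation, can be expressed directly.\<close>

definition lin :: "(nat \<Rightarrow> 'a) set \<Rightarrow> nat \<Rightarrow> ((nat \<Rightarrow> 'a) \<Rightarrow> nat \<Rightarrow> 'a) \<Rightarrow> bool" where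
  "lin V n f \<longleftrightarrow> (\<forall>v\<in>V. f v \<in> vecs R n) \<and>
     (\<forall>v\<in>V. \<forall>w\<in>V. f (\<lambda>i. v i \<oplus> w i) = (\<lambda>i. f v i \<oplus> f w i)) \<and>
     (\<forall>a\<in>carrier R. \<forall>v\<in>V. f (\<lambda>i. a \<otimes> v i) = (\<lambda>i. a \<otimes> f v i))"

lemma linD:
  assumes "lin V n f"
  shows lin_vecs: "v \<in> V \<Longrightarrow> f v \<in> vecs R n"
    and lin_add: "v \<in> V \<Longrightarrow> w \<in> V \<Longrightarrow> f (\<lambda>i. v i \<oplus> w i) = (\<lambda>i. f v i \<oplus> f w i)"
    and lin_smult: "a \<in> carrier R \<Longrightarrow> v \<in> V \<Longrightarrow> f (\<lambda>i. a \<otimes> v i) = (\<lambda>i. a \<otimes> f v i)"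
  using assms by (auto simp: lin_def)

lemma lin_zero:
  assumes "lin V n f" "vzero R \<in> V"
  shows "f (vzero R) = vzero R"
proof -
  have "f (vzero R) = (\<lambda>i. \<zero> \<otimes> f (vzero R) i)"
    using lin_smult[OF assms(1) zero_closed assms(2)] by (simp add: vzero_def)
  then show ?thesis using vecs_closed[OF lin_vecs[OF assms]] by (simp add: vzero_def)
qed

lemma lin_comp:
  assumes "lin V m f" "f ` V \<subseteq> W" "lin W n g"
  shows "lin V n (\<lambda>v. g (f v))"
  using assms unfolding lin_def by (auto simp: image_subset_iff)

lemma lin_cong:
  assumes "lin V n f" "submod R m V" "\<And>v. v \<in> V \<Longrightarrow> f' v = f v"
  shows "lin V n f'"
  using assms unfolding lin_def submod_vecs_iff by auto

lemma lin_subset: "lin V n f \<Longrightarrow> W \<subseteq> V \<Longrightarrow> lin W n f"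
  unfolding lin_def by blast

lemma lin_id: "V \<subseteq> vecs R n \<Longrightarrow> lin V n (\<lambda>v. v)"
  unfolding lin_def by blast

text \<open>Induction on the length \<open>k\<close> of a truncation of \<open>v\<close>: restoring
  one more entry adds one multiple of a unit vector.\<close>

lemma lin_expand:
  assumes f: "lin (vecs R r) n f" and v: "v \<in> vecs R r"
  shows "f v i = finsum R (\<lambda>j. v j \<otimes> f (unit_vec j) i) {..<r}"
proof -
  have "f (\<lambda>i. if i < k then v i else \<zero>) = (\<lambda>i. finsum R (\<lambda>j. v j \<otimes> f (unit_vec j) i) {..<k})" if "k \<le> r" for k
    using that
  proof (induction k)
    case 0
    show ?case using lin_zero[OF f vecs_zero] by (simp add: vzero_def)
  next
    case (Suc k)
    let ?t = "\<lambda>i. if i < k then v i else \<zero>"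
    have t: "?t \<in> vecs R r" using v Suc.prems by (auto simp: vecs_def)
    have e: "unit_vec k \<in> vecs R r" using Suc.prems by (simp add: unit_vec_vecs)
    have "(\<lambda>i. if i < Suc k then v i else \<zero>) = (\<lambda>i. ?t i \<oplus> v k \<otimes> unit_vec k i)"
      using vecs_closed[OF v] by (auto simp: unit_vec_def fun_eq_iff less_Suc_eq)
    then have "f (\<lambda>i. if i < Suc k then v i else \<zero>) = (\<lambda>i. f ?t i \<oplus> v k \<otimes> f (unit_vec k) i)"
      using lin_add[OF f t vecs_smult[OF vecs_closed[OF v] e]] lin_smult[OF f vecs_closed[OF v] e] by simp
    moreover have "finsum R (\<lambda>j. v j \<otimes> f (unit_vec j) i) {..<Suc k}
        = finsum R (\<lambda>j. v j \<otimes> f (unit_vec j) i) {..<k} \<oplus> v k \<otimes> f (unit_vec k) i" for i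
      using Suc.prems vecs_closed[OF v] vecs_closed[OF lin_vecs[OF f unit_vec_vecs]]
      by (intro finsum_lessThan_Suc) auto
    ultimately show ?case using Suc by simp
  qed
  from this[of r] have "f (\<lambda>i. if i < r then v i else \<zero>) i = finsum R (\<lambda>j. v j \<otimes> f (unit_vec j) i) {..<r}"
    by simp
  moreover have "(\<lambda>i. if i < r then v i else \<zero>) = v" using v by (auto simp: vecs_def)
  ultimately show ?thesis by simp
qed

lemma lin_eq_on_unit_vecs:
  assumes "lin (vecs R r) n f" "lin (vecs R r) m g" "v \<in> vecs R r"
    and "\<And>j. j < r \<Longrightarrow> f (unit_vec j) = g (unit_vec j)"
  shows "f v = g v"
proof
  fix i
  show "f v i = g v i"
    unfolding lin_expand[OF assms(1,3)] lin_expand[OF assms(2,3)]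
    using assms(4) vecs_closed[OF assms(3)] vecs_closed[OF lin_vecs[OF assms(2) unit_vec_vecs]]
    by (intro finsum_cong') auto
qed

lemma lin_columns:
  assumes b: "\<And>j. j < r \<Longrightarrow> b j \<in> vecs R n"
  shows "lin (vecs R r) n (\<lambda>v i. finsum R (\<lambda>j. v j \<otimes> b j i) {..<r})"
  unfolding lin_def
proof (intro conjI ballI ext)
  fix v assume v: "v \<in> vecs R r"
  note c = vecs_closed[OF v] vecs_closed[OF b]
  have "finsum R (\<lambda>j. v j \<otimes> b j i) {..<r} = finsum R (\<lambda>j. \<zero>) {..<r}" if "n \<le> i" for i
    using b c that by (intro finsum_cong') (auto simp: vecs_def)
  then show "(\<lambda>i. finsum R (\<lambda>j. v j \<otimes> b j i) {..<r}) \<in> vecs R n"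
    using c by (auto simp: vecs_def intro!: finsum_closed)
next
  fix v w i assume v: "v \<in> vecs R r" and w: "w \<in> vecs R r"
  note c = vecs_closed[OF v] vecs_closed[OF w] vecs_closed[OF b]
  have "finsum R (\<lambda>j. (v j \<oplus> w j) \<otimes> b j i) {..<r} = finsum R (\<lambda>j. v j \<otimes> b j i \<oplus> w j \<otimes> b j i) {..<r}"
    using c by (intro finsum_cong') (auto simp: l_distr)
  also have "\<dots> = finsum R (\<lambda>j. v j \<otimes> b j i) {..<r} \<oplus> finsum R (\<lambda>j. w j \<otimes> b j i) {..<r}"
    using c by (intro finsum_addf) auto
  finally show "finsum R (\<lambda>j. (v j \<oplus> w j) \<otimes> b j i) {..<r}
    = finsum R (\<lambda>j. v j \<otimes> b j i) {..<r} \<oplus> finsum R (\<lambda>j. w j \<otimes> b j i) {..<r}" .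
next
  fix a v i assume a: "a \<in> carrier R" and v: "v \<in> vecs R r"
  note c = vecs_closed[OF v] vecs_closed[OF b]
  have "a \<otimes> finsum R (\<lambda>j. v j \<otimes> b j i) {..<r} = finsum R (\<lambda>j. a \<otimes> (v j \<otimes> b j i)) {..<r}"
    using a c by (intro finsum_rdistr) auto
  also have "\<dots> = finsum R (\<lambda>j. a \<otimes> v j \<otimes> b j i) {..<r}"
    using a c by (intro finsum_cong') (auto simp: m_assoc)
  finally show "finsum R (\<lambda>j. a \<otimes> v j \<otimes> b j i) {..<r} = a \<otimes> finsum R (\<lambda>j. v j \<otimes> b j i) {..<r}" by simp
qed

lemma lin_minus:
  assumes "lin V n f" "submod R m V" "v \<in> V" "w \<in> V"
  shows "f (\<lambda>i. v i \<ominus> w i) = (\<lambda>i. f v i \<ominus> f w i)" "(\<lambda>i. v i \<ominus> w i) \<in> V"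
proof -
  have c: "x i \<in> carrier R" if "x \<in> V" for x i using assms that vecs_closed unfolding submod_def by blast
  have w: "(\<lambda>i. \<ominus> \<one> \<otimes> w i) \<in> V" using submod_smult[OF assms(2) _ assms(4)] by simp
  have eq: "(\<lambda>i. v i \<ominus> w i) = (\<lambda>i. v i \<oplus> \<ominus> \<one> \<otimes> w i)"
    using c assms by (simp add: fun_eq_iff minus_eq l_minus)
  show "(\<lambda>i. v i \<ominus> w i) \<in> V" unfolding eq by (rule submod_add[OF assms(2,3) w])
  show "f (\<lambda>i. v i \<ominus> w i) = (\<lambda>i. f v i \<ominus> f w i)"
    unfolding eq lin_add[OF assms(1,3) w] using lin_smult[OF assms(1) _ assms(4), of "\<ominus> \<one>"]
      vecs_closed[OF lin_vecs[OF assms(1)]] assms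
    by (simp add: fun_eq_iff minus_eq l_minus)
qed

lemma lin_inj_onI:
  assumes f: "lin V n f" "submod R m V" and ker: "\<And>v. v \<in> V \<Longrightarrow> f v = vzero R \<Longrightarrow> v = vzero R"
  shows "inj_on f V"
proof (rule inj_onI)
  fix v w assume vw: "v \<in> V" "w \<in> V" and eq: "f v = f w"
  have c: "x i \<in> carrier R" if "x \<in> V" for x i using f that vecs_closed unfolding submod_def by blast
  have "f (\<lambda>i. v i \<ominus> w i) = vzero R"
    using lin_minus(1)[OF f vw] eq vecs_closed[OF lin_vecs[OF f(1) vw(2)]]
    by (simp add: vzero_def minus_eq r_neg)
  then have "(\<lambda>i. v i \<ominus> w i) = vzero R" using ker lin_minus(2)[OF f vw] by blast
  then show "v = w" using c vw by (auto simp: fun_eq_iff vzero_def intro: eq_if_minus_eq_zero)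
qed

lemma lin_inv_into:
  assumes f: "lin V n f" "submod R m V" "inj_on f V"
  shows "lin (f ` V) m (inv_into V f)"
proof -
  have s: "x \<in> V \<Longrightarrow> y \<in> V \<Longrightarrow> (\<lambda>i. x i \<oplus> y i) \<in> V" "a \<in> carrier R \<Longrightarrow> x \<in> V \<Longrightarrow> (\<lambda>i. a \<otimes> x i) \<in> V"
    "x \<in> V \<Longrightarrow> x \<in> vecs R m" for x y a
    using submodD[OF f(2)] by auto
  show ?thesis
    unfolding lin_def
  proof (intro conjI ballI)
    fix v assume "v \<in> f ` V"
    then show "inv_into V f v \<in> vecs R m" using s(3) inv_into_into by metis
  next
    fix v w assume "v \<in> f ` V" "w \<in> f ` V"
    then obtain x y where xy: "x \<in> V" "y \<in> V" "v = f x" "w = f y" by blast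
    then show "inv_into V f (\<lambda>i. v i \<oplus> w i) = (\<lambda>i. inv_into V f v i \<oplus> inv_into V f w i)"
      using inv_into_f_f[OF f(3) s(1)[OF xy(1,2)]] lin_add[OF f(1) xy(1,2)] f(3) by simp
  next
    fix a v assume a: "a \<in> carrier R" and "v \<in> f ` V"
    then obtain x where x: "x \<in> V" "v = f x" by blast
    then show "inv_into V f (\<lambda>i. a \<otimes> v i) = (\<lambda>i. a \<otimes> inv_into V f v i)"
      using inv_into_f_f[OF f(3) s(2)[OF a x(1)]] lin_smult[OF f(1) a x(1)] f(3) by simp
  qed
qed

lemma submod_image:
  assumes f: "lin V n f" "submod R m V"
  shows "submod R n (f ` V)"
  unfolding submod_vecs_iff
proof (intro conjI ballI)
  have s: "x \<in> V \<Longrightarrow> y \<in> V \<Longrightarrow> (\<lambda>i. x i \<oplus> y i) \<in> V" "a \<in> carrier R \<Longrightarrow> x \<in> V \<Longrightarrow> (\<lambda>i. a \<otimes> x i) \<in> V"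
    "vzero R \<in> V" for x y a
    using submodD[OF f(2)] by auto
  show "f ` V \<subseteq> vecs R n" using lin_vecs[OF f(1)] by blast
  show "vzero R \<in> f ` V" using lin_zero[OF f(1) s(3)] s(3) by force
  show "(\<lambda>i. v i \<oplus> w i) \<in> f ` V" if vw: "v \<in> f ` V" "w \<in> f ` V" for v w
  proof -
    obtain x y where xy: "x \<in> V" "y \<in> V" "v = f x" "w = f y" using vw by blast
    show ?thesis using imageI[OF s(1)[OF xy(1,2)], of f] unfolding lin_add[OF f(1) xy(1,2)] xy .
  qed
  show "(\<lambda>i. a \<otimes> v i) \<in> f ` V" if av: "a \<in> carrier R" "v \<in> f ` V" for a v
  proof -
    obtain x where x: "x \<in> V" "v = f x" using av by blast
    show ?thesis using imageI[OF s(2)[OF av(1) x(1)], of f] unfolding lin_smult[OF f(1) av(1) x(1)] x .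
  qed
qed

end

locale finite_cring = cring +
  assumes finite_carrier: "finite (carrier R)"
begin

section \<open>Stable range one for finite commutative rings\<close>

lemma finite_vecs: "finite (vecs R n)"
\<comment> \<open>\<open>card\<close> of an infinite set is zero, so a positive count already proves
  finiteness.\<close>
proof (rule card_ge_0_finite)
  have "carrier R \<noteq> {}" by blast
  then show "card (vecs R n) > 0" using finite_carrier by (simp add: card_vecs card_gt_0_iff)
qed

text \<open>Multiplication by a regular element is an injective self-map of a finite set, hence
  takes the value 1.\<close>

lemma unit_if_regular:
  assumes a: "a \<in> carrier R" and reg: "\<And>x. x \<in> carrier R \<Longrightarrow> a \<otimes> x = \<zero> \<Longrightarrow> x = \<zero>"
  shows "\<exists>b\<in>carrier R. a \<otimes> b = \<one>"
proof -
  have "inj_on (\<lambda>x. a \<otimes> x) (carrier R)"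
  proof (rule inj_onI)
    fix x y assume xy: "x \<in> carrier R" "y \<in> carrier R" "a \<otimes> x = a \<otimes> y"
    have "a \<otimes> (x \<ominus> y) = a \<otimes> x \<ominus> a \<otimes> y" using a xy(1,2) by algebra
    also have "\<dots> = \<zero>" using xy a by (simp add: minus_eq r_neg)
    finally have "x \<ominus> y = \<zero>" using reg xy by simp
    then show "x = y" using xy eq_if_minus_eq_zero by blast
  qed
  then have "(\<lambda>x. a \<otimes> x) ` carrier R = carrier R"
    using a by (intro endo_inj_surj[OF finite_carrier]) auto
  then have "\<one> \<in> (\<lambda>x. a \<otimes> x) ` carrier R" by simp
  then obtain b where "b \<in> carrier R" "\<one> = a \<otimes> b" by (rule imageE)
  then show ?thesis by auto
qed

text \<open>The powers of \<open>a\<close> are eventually periodic, and an exponent in the periodic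
  range that is a multiple of the period gives an idempotent. The exponent is kept positive so that
  one factor \<open>a\<close> can be split off.\<close>

lemma idempotent_power:
  assumes a: "a \<in> carrier R"
  shows "\<exists>m::nat. a [^] Suc m \<otimes> a [^] Suc m = a [^] Suc m"
proof -
  have "\<not> inj (\<lambda>k::nat. a [^] k)"
  proof
    assume "inj (\<lambda>k::nat. a [^] k)"
    then have "infinite (range (\<lambda>k::nat. a [^] k))" by (simp add: finite_image_iff)
    moreover have "range (\<lambda>k::nat. a [^] k) \<subseteq> carrier R" using a by auto
    ultimately show False using finite_carrier finite_subset by blast
  qed
  then obtain i j :: nat where "i < j" and ij: "a [^] i = a [^] j"
    unfolding inj_on_def by (metis linorder_neq_iff)
  define d where "d = j - i"
  have d: "d > 0" "j = i + d" using \<open>i < j\<close> by (auto simp: d_def)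
  have step: "a [^] (k + d) = a [^] k" if ik: "i \<le> k" for k
  proof -
    obtain q where "k = i + q" using le_Suc_ex[OF ik] by (rule exE)
    then have "a [^] (k + d) = a [^] (j + q)" using d by (simp add: add_ac)
    also have "\<dots> = a [^] i \<otimes> a [^] q" using ij a by (simp add: nat_pow_mult[OF a, symmetric])
    also have "\<dots> = a [^] k" using \<open>k = i + q\<close> by (simp add: nat_pow_mult[OF a])
    finally show ?thesis .
  qed
  have steps: "a [^] (k + q * d) = a [^] k" if "i \<le> k" for k q
  proof (induction q)
    case (Suc q)
    then show ?case using step[of "k + q * d"] that by (simp add: add_ac)
  qed simp
  \<comment> \<open>The exponent \<open>Suc i * d\<close> is a multiple of the period
    \<open>d\<close>, and at least \<open>i\<close> because \<open>d\<close> is positive.\<close>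
  have "a [^] (Suc i * d) \<otimes> a [^] (Suc i * d) = a [^] (Suc i * d + Suc i * d)"
    using a by (simp add: nat_pow_mult)
  also have "\<dots> = a [^] (Suc i * d)"
  proof (rule steps)
    have "i * 1 \<le> Suc i * d" using d by (intro mult_le_mono) auto
    then show "i \<le> Suc i * d" by simp
  qed
  finally have "a [^] (Suc i * d) \<otimes> a [^] (Suc i * d) = a [^] (Suc i * d)" .
  moreover obtain m where "Suc i * d = Suc m" using d by (cases "Suc i * d") auto
  ultimately show ?thesis by metis
qed

text \<open>An idempotent power \<open>e\<close> of \<open>a\<close> splits the ring. On the part
  cut out by \<open>e\<close> the element \<open>a\<close> is a unit; on the complement
  \<open>a\<close> is nilpotent, so \<open>b\<close>, being 1 minus a multiple of \<open>a\<close>,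
  is a unit there and stays one after adding \<open>a\<close>. This suggests s = 1 - e. The proof
  checks that the resulting element is regular instead of exhibiting an inverse.\<close>

lemma stable_range_one:
  assumes c: "a \<in> carrier R" "b \<in> carrier R" "l \<in> carrier R" and unimodular: "l \<otimes> a \<oplus> b = \<one>"
  shows "\<exists>s\<in>carrier R. \<exists>u\<in>carrier R. (a \<oplus> s \<otimes> b) \<otimes> u = \<one>"
proof -
  obtain m :: nat where idem: "a [^] Suc m \<otimes> a [^] Suc m = a [^] Suc m"
    using idempotent_power c by blast
  define e where "e = a [^] Suc m"
  have e: "e \<in> carrier R" "e \<otimes> e = e" using c idem by (auto simp: e_def)
  have "x = \<zero>" if x: "x \<in> carrier R" and tx: "(a \<oplus> (\<one> \<ominus> e) \<otimes> b) \<otimes> x = \<zero>" for x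
  proof -
    \<comment> \<open>Projecting to the part of \<open>e\<close> removes the term with
      \<open>b\<close>, since \<open>e\<close> is idempotent.\<close>
    have "e \<otimes> ((a \<oplus> (\<one> \<ominus> e) \<otimes> b) \<otimes> x) = a \<otimes> (e \<otimes> x) \<oplus> (e \<ominus> e \<otimes> e) \<otimes> (b \<otimes> x)"
      using c(1,2) e(1) x by algebra
    also have "\<dots> = a \<otimes> (e \<otimes> x)" using e c x by (simp add: minus_eq r_neg)
    finally have "a \<otimes> (e \<otimes> x) = \<zero>" using e tx by simp
    \<comment> \<open>Completes the factor \<open>a\<close> to the power that defines
      \<open>e\<close>.\<close>
    then have "a [^] m \<otimes> (a \<otimes> (e \<otimes> x)) = \<zero>" using c by simp
    moreover have "a [^] m \<otimes> (a \<otimes> (e \<otimes> x)) = e \<otimes> e \<otimes> x"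
      using c e(1) x by (simp add: e_def m_assoc)
    ultimately have ex: "e \<otimes> x = \<zero>" using e by simp
    have b: "b = \<one> \<ominus> l \<otimes> a"
    proof -
      have "b = (l \<otimes> a \<oplus> b) \<ominus> l \<otimes> a" using c by algebra
      then show ?thesis using unimodular by simp
    qed
    have "(a \<oplus> (\<one> \<ominus> e) \<otimes> b) \<otimes> x = a \<otimes> x \<oplus> b \<otimes> x \<ominus> b \<otimes> (e \<otimes> x)"
      using c(1,2) e(1) x by algebra
    then have "a \<otimes> x \<oplus> b \<otimes> x = \<zero>" using ex tx c x by (simp add: minus_eq)
    moreover have "a \<otimes> x \<oplus> (\<one> \<ominus> l \<otimes> a) \<otimes> x = x \<ominus> (l \<ominus> \<one>) \<otimes> a \<otimes> x"
      using c(1,3) x by algebra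
    ultimately have "x \<ominus> (l \<ominus> \<one>) \<otimes> a \<otimes> x = \<zero>" using b by simp
    \<comment> \<open>With \<open>e\<close> annihilating \<open>x\<close>, multiplication by (l - 1)
      a fixes \<open>x\<close>. Iterating this brings in the power \<open>e\<close> of
      \<open>a\<close>, which kills \<open>x\<close>.\<close>
    then have step: "(l \<ominus> \<one>) \<otimes> a \<otimes> x = x" using x c eq_if_minus_eq_zero by (metis m_closed minus_closed one_closed)
    define d where "d = l \<ominus> \<one>"
    have d: "d \<in> carrier R" using c by (simp add: d_def)
    have "d [^] k \<otimes> (a [^] k \<otimes> x) = x" for k :: nat
    proof (induction k)
      case (Suc k)
      have "d [^] Suc k \<otimes> (a [^] Suc k \<otimes> x) = d [^] k \<otimes> (a [^] k \<otimes> (d \<otimes> a \<otimes> x))"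
        using d c x by (simp add: m_ac)
      then show ?case using Suc step by (simp add: d_def)
    qed (use x in simp)
    from this[of "Suc m"] have "d [^] Suc m \<otimes> (e \<otimes> x) = x" by (simp only: e_def)
    then show "x = \<zero>" using ex d by simp
  qed
  then have "\<exists>u\<in>carrier R. (a \<oplus> (\<one> \<ominus> e) \<otimes> b) \<otimes> u = \<one>"
    using c e by (intro unit_if_regular) auto
  then show ?thesis using e by (meson minus_closed one_closed)
qed

section \<open>Matrices as linear maps\<close>

lemma mat_vec_columns:
  assumes "g \<in> mats R n" "v \<in> vecs R n"
  shows "mat_vec R n g v = (\<lambda>i. finsum R (\<lambda>j. v j \<otimes> g i j) {..<n})"
proof
  fix i
  note c = vecs_closed[OF assms(2)]
  show "mat_vec R n g v i = finsum R (\<lambda>j. v j \<otimes> g i j) {..<n}"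
  proof (cases "i < n")
    case True
    have "finsum R (\<lambda>j. g i j \<otimes> v j) {..<n} = finsum R (\<lambda>j. v j \<otimes> g i j) {..<n}"
      using assms(1) True c by (intro finsum_cong') (auto simp: mats_def m_comm)
    then show ?thesis using True by (simp add: mat_vec_def)
  next
    case False
    have "finsum R (\<lambda>j. v j \<otimes> g i j) {..<n} = finsum R (\<lambda>j. \<zero>) {..<n}"
      using assms(1) False c by (intro finsum_cong') (auto simp: mats_def)
    then show ?thesis using False by (simp add: mat_vec_def)
  qed
qed

lemma mats_column: "g \<in> mats R n \<Longrightarrow> (\<lambda>i. g i j) \<in> vecs R n"
  by (cases "j < n") (auto simp: mats_def vecs_def)

lemma lin_mat_vec:
  assumes "g \<in> mats R n"
  shows "lin (vecs R n) n (mat_vec R n g)"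
  by (rule lin_cong[OF lin_columns[of n "\<lambda>j i. g i j"] submod_vecs])
    (auto simp: mat_vec_columns assms mats_column)

lemma mat_vec_vecs: "g \<in> mats R n \<Longrightarrow> v \<in> vecs R n \<Longrightarrow> mat_vec R n g v \<in> vecs R n"
  using lin_mat_vec lin_vecs by blast

lemma mat_vec_unit_vec:
  assumes g: "g \<in> mats R n" and "j < n"
  shows "mat_vec R n g (unit_vec j) = (\<lambda>i. g i j)"
proof
  fix i
  have c: "g i k \<in> carrier R" for k using vecs_closed[OF mats_column[OF g]] .
  have "finsum R (\<lambda>k. unit_vec j k \<otimes> g i k) {..<n} = finsum R (\<lambda>k. if j = k then g i k else \<zero>) {..<n}"
    using c by (intro finsum_cong') (auto simp: unit_vec_def)
  also have "\<dots> = g i j" using c \<open>j < n\<close> by (intro finsum_singleton) auto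
  finally show "mat_vec R n g (unit_vec j) i = g i j"
    using mat_vec_columns[OF g unit_vec_vecs[OF \<open>j < n\<close>]] by simp
qed

lemma mat_mul_mats: "g \<in> mats R n \<Longrightarrow> h \<in> mats R n \<Longrightarrow> mat_mul R n g h \<in> mats R n"
  unfolding mats_def mat_mul_def by (auto intro!: finsum_closed)

lemma mat_one_mats: "mat_one R n \<in> mats R n"
  unfolding mats_def mat_one_def by auto

lemma mat_vec_mat_one: "v \<in> vecs R n \<Longrightarrow> mat_vec R n (mat_one R n) v = v"
  by (rule lin_eq_on_unit_vecs[OF lin_mat_vec[OF mat_one_mats] lin_id])
    (auto simp: mat_vec_unit_vec mat_one_mats, auto simp: mat_one_def unit_vec_def)

lemma mat_vec_mat_mul:
  assumes g: "g \<in> mats R n" and h: "h \<in> mats R n" and v: "v \<in> vecs R n"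
  shows "mat_vec R n (mat_mul R n g h) v = mat_vec R n g (mat_vec R n h v)"
proof (rule lin_eq_on_unit_vecs[OF lin_mat_vec[OF mat_mul_mats[OF g h]] lin_comp[OF lin_mat_vec[OF h] _ lin_mat_vec[OF g]] v])
  show "mat_vec R n h ` vecs R n \<subseteq> vecs R n" using mat_vec_vecs h by blast
  show "mat_vec R n (mat_mul R n g h) (unit_vec j) = mat_vec R n g (mat_vec R n h (unit_vec j))" if "j < n" for j
    using that by (simp add: mat_vec_unit_vec mat_mul_mats g h) (simp add: mat_mul_def mat_vec_def fun_eq_iff)
qed

lemma mats_eqI:
  assumes "g \<in> mats R n" "h \<in> mats R n" "\<And>v. v \<in> vecs R n \<Longrightarrow> mat_vec R n g v = mat_vec R n h v"
  shows "g = h"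
proof (intro ext)
  fix i j
  show "g i j = h i j"
  proof (cases "j < n")
    case True
    then show ?thesis using assms(3)[OF unit_vec_vecs[OF True]] assms(1,2)
      by (simp add: mat_vec_unit_vec fun_eq_iff)
  qed (use assms(1,2) in \<open>auto simp: mats_def\<close>)
qed

lemma lin_imp_mat_vec:
  assumes f: "lin (vecs R n) n f"
  shows "\<exists>g\<in>mats R n. \<forall>v\<in>vecs R n. mat_vec R n g v = f v"
proof (intro bexI ballI)
  define g where "g = (\<lambda>i j. if i < n \<and> j < n then f (unit_vec j) i else \<zero>)"
  show g: "g \<in> mats R n"
    using vecs_closed[OF lin_vecs[OF f unit_vec_vecs]] by (auto simp: mats_def g_def)
  show "mat_vec R n g v = f v" if "v \<in> vecs R n" for v
  proof (rule lin_eq_on_unit_vecs[OF lin_mat_vec[OF g] f that])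
    fix j assume "j < n"
    then show "mat_vec R n g (unit_vec j) = f (unit_vec j)"
      using lin_vecs[OF f unit_vec_vecs] unfolding mat_vec_unit_vec[OF g \<open>j < n\<close>]
      by (auto simp: g_def vecs_def fun_eq_iff)
  qed
qed

lemma lin_inj_imp_image:
  assumes "lin (vecs R n) n f" "inj_on f (vecs R n)"
  shows "f ` vecs R n = vecs R n"
  using assms lin_vecs[OF assms(1)] by (intro endo_inj_surj finite_vecs) auto

text \<open>An injective endomorphism of a finite module is onto, and its set-theoretic inverse is
  again linear, hence given by a matrix.\<close>

lemma GL_iff: "g \<in> GL R n \<longleftrightarrow> g \<in> mats R n \<and> inj_on (mat_vec R n g) (vecs R n)"
proof safe
  assume "g \<in> GL R n"
  then obtain h where g: "g \<in> mats R n" and h: "h \<in> mats R n" "mat_mul R n h g = mat_one R n"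
    by (auto simp: GL_def)
  show "g \<in> mats R n" by fact
  show "inj_on (mat_vec R n g) (vecs R n)"
    by (rule inj_on_inverseI[where g="mat_vec R n h"])
      (simp add: mat_vec_mat_mul[symmetric] g h mat_vec_mat_one)
next
  assume g: "g \<in> mats R n" and inj: "inj_on (mat_vec R n g) (vecs R n)"
  note im = lin_inj_imp_image[OF lin_mat_vec[OF g] inj]
  have "lin (vecs R n) n (inv_into (vecs R n) (mat_vec R n g))"
    using lin_inv_into[OF lin_mat_vec[OF g] submod_vecs[OF order_refl] inj] im by simp
  then obtain h where h: "h \<in> mats R n"
    and hv: "\<And>v. v \<in> vecs R n \<Longrightarrow> mat_vec R n h v = inv_into (vecs R n) (mat_vec R n g) v"
    using lin_imp_mat_vec by blast
  have "mat_mul R n g h = mat_one R n"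
    using g h hv im by (intro mats_eqI[of _ n])
      (auto simp: mat_mul_mats mat_one_mats mat_vec_mat_mul mat_vec_mat_one f_inv_into_f)
  moreover have "mat_mul R n h g = mat_one R n"
    using g h hv inj by (intro mats_eqI[of _ n])
      (auto simp: mat_mul_mats mat_one_mats mat_vec_mat_mul mat_vec_mat_one mat_vec_vecs)
  ultimately show "g \<in> GL R n" using g h by (auto simp: GL_def)
qed

lemma GL_mats: "g \<in> GL R n \<Longrightarrow> g \<in> mats R n"
  by (simp add: GL_def)

lemma mat_vec_GL_image: "g \<in> GL R n \<Longrightarrow> mat_vec R n g ` vecs R n = vecs R n"
  using lin_inj_imp_image[OF lin_mat_vec] GL_iff by blast

lemma lin_inj_imp_GL:
  assumes "lin (vecs R n) n f" "inj_on f (vecs R n)"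
  shows "\<exists>g\<in>GL R n. \<forall>v\<in>vecs R n. mat_vec R n g v = f v"
proof -
  obtain g where g: "g \<in> mats R n" "\<And>v. v \<in> vecs R n \<Longrightarrow> mat_vec R n g v = f v"
    using lin_imp_mat_vec[OF assms(1)] by blast
  then have "inj_on (mat_vec R n g) (vecs R n)" using assms(2) by (simp cong: inj_on_cong)
  then show ?thesis using g GL_iff by blast
qed

lemma GL_inverse:
  assumes "g \<in> GL R n"
  shows "\<exists>h\<in>GL R n. mat_mul R n g h = mat_one R n \<and> mat_mul R n h g = mat_one R n \<and>
    (\<forall>v\<in>vecs R n. mat_vec R n g (mat_vec R n h v) = v \<and> mat_vec R n h (mat_vec R n g v) = v)"
proof -
  obtain h where h: "h \<in> mats R n" "mat_mul R n g h = mat_one R n" "mat_mul R n h g = mat_one R n"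
    using assms by (auto simp: GL_def)
  note g = GL_mats[OF assms]
  have "h \<in> GL R n" using h g by (auto simp: GL_def)
  moreover have "\<forall>v\<in>vecs R n. mat_vec R n g (mat_vec R n h v) = v \<and> mat_vec R n h (mat_vec R n g v) = v"
    by (simp add: mat_vec_mat_mul[symmetric] g h mat_vec_mat_one)
  ultimately show ?thesis using h by blast
qed

lemma GL_mult:
  assumes g: "g \<in> GL R n" and h: "h \<in> GL R n"
  shows "mat_mul R n g h \<in> GL R n"
proof -
  have "inj_on (mat_vec R n g \<circ> mat_vec R n h) (vecs R n)"
    using g h mat_vec_GL_image[OF h] by (intro comp_inj_on) (simp_all add: GL_iff)
  then have "inj_on (mat_vec R n (mat_mul R n g h)) (vecs R n)"
    using g h by (simp add: mat_vec_mat_mul GL_mats o_def cong: inj_on_cong)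
  then show ?thesis using g h by (simp add: GL_iff mat_mul_mats)
qed

lemma GL_one: "mat_one R n \<in> GL R n"
  by (simp add: GL_iff mat_one_mats inj_on_def mat_vec_mat_one)

end

section \<open>Free direct summands\<close>

context finite_cring
begin

text \<open>Bridge between the coefficient lists in the definitions of freeness and the zero-padded
  vectors on which linear maps act.\<close>

definition list_vec :: "'a list \<Rightarrow> nat \<Rightarrow> 'a" where
  "list_vec cs = (\<lambda>i. if i < length cs then cs ! i else \<zero>)"

lemma list_vec_vecs: "set cs \<subseteq> carrier R \<Longrightarrow> list_vec cs \<in> vecs R (length cs)"
  by (auto simp: list_vec_def vecs_def)

lemma list_vec_map: "v \<in> vecs R r \<Longrightarrow> list_vec (map v [0..<r]) = v"
  by (auto simp: list_vec_def vecs_def fun_eq_iff)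

lemma list_vec_inject:
  assumes "length cs = length ds" "list_vec cs = list_vec ds"
  shows "cs = ds"
proof (rule nth_equalityI[OF assms(1)])
  fix i assume "i < length cs"
  then show "cs ! i = ds ! i" using fun_cong[OF assms(2), of i] assms(1) by (simp add: list_vec_def)
qed

lemma lincomb_submod:
  assumes V: "submod R n V"
  shows "length cs = length bs \<Longrightarrow> set bs \<subseteq> V \<Longrightarrow> set cs \<subseteq> carrier R \<Longrightarrow> lincomb R n cs bs \<in> V"
proof (induction cs bs rule: list_induct2)
  case Nil
  then show ?case using submod_zero[OF V] by (simp add: lincomb_def)
next
  case (Cons c cs b bs)
  have "lincomb R n (c # cs) (b # bs) = vadd R n (vsmult R n c b) (lincomb R n cs bs)"
    by (simp add: lincomb_def)
  then show ?case using Cons V by (simp add: submod_def)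
qed

lemma lincomb_eq_finsum:
  "length cs = length bs \<Longrightarrow> set bs \<subseteq> vecs R n \<Longrightarrow> set cs \<subseteq> carrier R \<Longrightarrow>
    lincomb R n cs bs i = finsum R (\<lambda>j. cs ! j \<otimes> (bs ! j) i) {..<length bs}"
proof (induction cs bs rule: list_induct2)
  case Nil
  then show ?case by (simp add: lincomb_def vzero_def)
next
  case (Cons c cs b bs)
  have m: "lincomb R n cs bs \<in> vecs R n"
    using Cons by (intro lincomb_submod submod_vecs) auto
  have "lincomb R n (c # cs) (b # bs) = vadd R n (vsmult R n c b) (lincomb R n cs bs)"
    by (simp add: lincomb_def)
  also have "\<dots> = (\<lambda>i. c \<otimes> b i \<oplus> lincomb R n cs bs i)"
    using Cons.prems m by (subst vadd_vecs) (auto simp: vsmult_vecs vecs_smult)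
  finally have "lincomb R n (c # cs) (b # bs) i = c \<otimes> b i \<oplus> finsum R (\<lambda>j. cs ! j \<otimes> (bs ! j) i) {..<length bs}"
    using Cons by simp
  moreover have "finsum R (\<lambda>j. (c # cs) ! j \<otimes> ((b # bs) ! j) i) {..<Suc (length bs)}
    = (c # cs) ! 0 \<otimes> ((b # bs) ! 0) i \<oplus> finsum R (\<lambda>j. (c # cs) ! Suc j \<otimes> ((b # bs) ! Suc j) i) {..<length bs}"
  proof (rule finsum_lessThan_Suc_shift)
    fix j assume j: "j \<le> length bs"
    have "(b # bs) ! j \<in> set (b # bs)" using j by (intro nth_mem) simp
    moreover have "(c # cs) ! j \<in> set (c # cs)" using j Cons.hyps by (intro nth_mem) simp
    ultimately have "(b # bs) ! j \<in> vecs R n" "(c # cs) ! j \<in> carrier R" using Cons.prems by blast+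
    then show "(c # cs) ! j \<otimes> ((b # bs) ! j) i \<in> carrier R" using vecs_closed by simp
  qed
  ultimately show ?case by simp
qed

text \<open>Turns a linear combination of the images of unit vectors into one application of
  \<open>f\<close>, so that uniqueness of coefficients becomes injectivity of
  \<open>f\<close>.\<close>

lemma lincomb_lin_images:
  assumes f: "lin (vecs R r) n f" and cs: "length cs = r" "set cs \<subseteq> carrier R"
  shows "lincomb R n cs (map (\<lambda>j. f (unit_vec j)) [0..<r]) = f (list_vec cs)"
proof
  fix i
  have c: "cs ! j \<in> carrier R" if "j < r" for j using cs that nth_mem by blast
  have v: "f (unit_vec j) \<in> vecs R n" if "j < r" for j using lin_vecs[OF f unit_vec_vecs[OF that]] .
  have "lincomb R n cs (map (\<lambda>j. f (unit_vec j)) [0..<r]) i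
      = finsum R (\<lambda>j. cs ! j \<otimes> (map (\<lambda>j. f (unit_vec j)) [0..<r] ! j) i) {..<r}"
    using cs v by (subst lincomb_eq_finsum) auto
  also have "\<dots> = finsum R (\<lambda>j. list_vec cs j \<otimes> f (unit_vec j) i) {..<r}"
    using cs c vecs_closed[OF v] by (intro finsum_cong') (auto simp: list_vec_def)
  also have "\<dots> = f (list_vec cs) i"
    using lin_expand[OF f] list_vec_vecs cs by auto
  finally show "lincomb R n cs (map (\<lambda>j. f (unit_vec j)) [0..<r]) i = f (list_vec cs) i" .
qed

lemma free_submodI:
  assumes f: "lin (vecs R r) n f" "inj_on f (vecs R r)"
  shows "free_submod R n (f ` vecs R r)"
  unfolding free_submod_def
proof (intro conjI exI ballI)
  let ?bs = "map (\<lambda>j. f (unit_vec j)) [0..<r]"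
  show "submod R n (f ` vecs R r)" using submod_image[OF f(1) submod_vecs] by blast
  show "set ?bs \<subseteq> f ` vecs R r" using unit_vec_vecs by auto
  fix v assume "v \<in> f ` vecs R r"
  then obtain x where x: "x \<in> vecs R r" "v = f x" by blast
  show "\<exists>!cs. length cs = length ?bs \<and> set cs \<subseteq> carrier R \<and> lincomb R n cs ?bs = v"
  proof (rule ex1I[of _ "map x [0..<r]"])
    have "set (map x [0..<r]) \<subseteq> carrier R" using vecs_closed[OF x(1)] by auto
    then show "length (map x [0..<r]) = length ?bs \<and> set (map x [0..<r]) \<subseteq> carrier R
        \<and> lincomb R n (map x [0..<r]) ?bs = v"
      using lincomb_lin_images[OF f(1), of "map x [0..<r]"] x by (simp add: list_vec_map)
    fix cs assume cs: "length cs = length ?bs \<and> set cs \<subseteq> carrier R \<and> lincomb R n cs ?bs = v"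
    then have "f (list_vec cs) = f x" using lincomb_lin_images[OF f(1), of cs] x by simp
    then have "list_vec cs = x"
      using f(2) x list_vec_vecs[of cs] cs by (simp add: inj_on_eq_iff)
    then show "cs = map x [0..<r]"
      using cs x by (intro list_vec_inject) (auto simp: list_vec_map)
  qed
qed

text \<open>Converse of \<open>free_submodI\<close>: existence of coefficients identifies the image
  of the parametrisation, their uniqueness makes it injective.\<close>

lemma free_submodE:
  assumes "free_submod R n V"
  obtains r f where "lin (vecs R r) n f" "inj_on f (vecs R r)" "V = f ` vecs R r"
proof -
  obtain bs where V: "submod R n V" and bs: "set bs \<subseteq> V"
    and ex: "\<forall>v\<in>V. \<exists>!cs. length cs = length bs \<and> set cs \<subseteq> carrier R \<and> lincomb R n cs bs = v"
    using assms unfolding free_submod_def by (elim conjE exE) (rule that; assumption)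
  note ex1 = bspec[OF ex]
  define r where "r = length bs"
  define f where "f = (\<lambda>v i. finsum R (\<lambda>j. v j \<otimes> (bs ! j) i) {..<r})"
  have bsv: "set bs \<subseteq> vecs R n" using bs submod_subset[OF V] by blast
  have bsn: "bs ! j \<in> vecs R n" if "j < r" for j using that bsv nth_mem by (auto simp: r_def)
  have f: "lin (vecs R r) n f" unfolding f_def by (rule lin_columns) (rule bsn)
  have lc: "lincomb R n (map v [0..<r]) bs = f v" if v: "v \<in> vecs R r" for v
  proof
    fix i
    have "set (map v [0..<r]) \<subseteq> carrier R" using vecs_closed[OF v] by auto
    then have "lincomb R n (map v [0..<r]) bs i
        = finsum R (\<lambda>j. (map v [0..<r]) ! j \<otimes> (bs ! j) i) {..<length bs}"
      using bsv by (intro lincomb_eq_finsum) (auto simp: r_def)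
    also have "\<dots> = f v i"
      unfolding f_def r_def[symmetric] using vecs_closed[OF v] vecs_closed[OF bsn] by (intro finsum_cong') auto
    finally show "lincomb R n (map v [0..<r]) bs i = f v i" .
  qed
  have cl: "set (map v [0..<r]) \<subseteq> carrier R" if "v \<in> vecs R r" for v using vecs_closed[OF that] by auto
  have sub: "f v \<in> V" if "v \<in> vecs R r" for v
    using lincomb_submod[OF V, of "map v [0..<r]" bs] lc[OF that] cl[OF that] bs by (simp add: r_def)
  have "inj_on f (vecs R r)"
  proof (rule inj_onI)
    fix v w assume vw: "v \<in> vecs R r" "w \<in> vecs R r" "f v = f w"
    note the = the1_equality[OF ex1[OF sub[OF vw(1)]]]
    have "map v [0..<r] = map w [0..<r]"
      by (rule trans[OF the[symmetric] the])
        (use lc[OF vw(1)] lc[OF vw(2)] cl[OF vw(1)] cl[OF vw(2)] vw(3) in \<open>simp_all add: r_def\<close>)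
    then have "list_vec (map v [0..<r]) = list_vec (map w [0..<r])" by (rule arg_cong)
    then show "v = w" by (simp only: list_vec_map[OF vw(1)] list_vec_map[OF vw(2)])
  qed
  moreover have "V = f ` vecs R r"
  proof (rule equalityI; rule subsetI)
    fix v assume "v \<in> V"
    then obtain cs where cs: "length cs = length bs" "set cs \<subseteq> carrier R" "lincomb R n cs bs = v"
      using ex1 by blast
    have lv: "list_vec cs \<in> vecs R r" using list_vec_vecs[OF cs(2)] cs(1) by (simp add: r_def)
    have "map (list_vec cs) [0..<r] = cs"
      using cs(1) by (intro nth_equalityI) (auto simp: list_vec_def r_def)
    then have "f (list_vec cs) = v" using lc[OF lv] cs by simp
    then show "v \<in> f ` vecs R r" using lv by blast
  next
    fix v assume "v \<in> f ` vecs R r" then show "v \<in> V" using sub by auto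
  qed
  ultimately show thesis using that f by blast
qed

text \<open>The complement is the kernel of the projection \<open>p\<close>, through x = p x + (x -
  p x).\<close>

lemma direct_summandI:
  assumes p: "lin (vecs R n) n p" "\<And>x. x \<in> vecs R n \<Longrightarrow> p x \<in> V" "\<And>v. v \<in> V \<Longrightarrow> p v = v"
    and V: "submod R n V"
  shows "direct_summand R n V"
  unfolding direct_summand_def
proof (intro conjI exI ballI)
  let ?W = "{x \<in> vecs R n. p x = vzero R}"
  show "submod R n V" by fact
  show "submod R n ?W"
    unfolding submod_vecs_iff using lin_zero[OF p(1) vecs_zero]
    by (auto simp: lin_add[OF p(1)] lin_smult[OF p(1)] vecs_add vecs_smult vecs_zero) (auto simp: vzero_def)
  fix x assume x: "x \<in> vecs R n"
  have px: "p x \<in> vecs R n" using lin_vecs[OF p(1) x] .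
  note m = lin_minus[OF p(1) submod_vecs[OF order_refl] x px]
  let ?w = "\<lambda>i. x i \<ominus> p x i"
  show "\<exists>!q. fst q \<in> V \<and> snd q \<in> ?W \<and> x = vadd R n (fst q) (snd q)"
  proof (rule ex1I[of _ "(p x, ?w)"])
    have "p ?w = vzero R"
      using m(1) p(2,3) x vecs_closed[OF px] by (simp add: vzero_def minus_eq r_neg)
    moreover have "vadd R n (p x) ?w = x"
    proof -
      have "p x i \<oplus> (x i \<ominus> p x i) = x i" for i
        using vecs_closed[OF px, of i] vecs_closed[OF x, of i] by algebra
      then show ?thesis using m(2) px by (simp add: vadd_vecs)
    qed
    ultimately show "fst (p x, ?w) \<in> V \<and> snd (p x, ?w) \<in> ?W \<and> x = vadd R n (fst (p x, ?w)) (snd (p x, ?w))"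
      using p(2) x m(2) by simp
    fix q assume q: "fst q \<in> V \<and> snd q \<in> ?W \<and> x = vadd R n (fst q) (snd q)"
    have f: "fst q \<in> vecs R n" using q submod_subset[OF V] by blast
    have s: "snd q \<in> vecs R n" using q by simp
    have xe: "x = (\<lambda>i. fst q i \<oplus> snd q i)" using q vadd_vecs[OF f s] by simp
    have "p x = (\<lambda>i. p (fst q) i \<oplus> p (snd q) i)" unfolding xe by (rule lin_add[OF p(1) f s])
    then have 1: "p x = fst q" using q p(3) vecs_closed[OF f] by (simp add: vzero_def)
    have "snd q i = (fst q i \<oplus> snd q i) \<ominus> fst q i" for i
      using vecs_closed[OF f, of i] vecs_closed[OF s, of i] by algebra
    then have "snd q i = x i \<ominus> p x i" for i
      using 1 fun_cong[OF xe, of i] by simp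
    then show "q = (p x, ?w)" using 1 by (cases q) auto
  qed
qed

lemma direct_summand_projection:
  assumes "direct_summand R n V"
  obtains p where "lin (vecs R n) n p" "\<And>x. x \<in> vecs R n \<Longrightarrow> p x \<in> V" "\<And>v. v \<in> V \<Longrightarrow> p v = v"
proof -
  obtain W where V: "submod R n V" and W: "submod R n W"
    and ex1: "\<And>x. x \<in> vecs R n \<Longrightarrow> \<exists>!q. fst q \<in> V \<and> snd q \<in> W \<and> x = vadd R n (fst q) (snd q)"
    using assms unfolding direct_summand_def by blast
  note Vv = subsetD[OF submod_subset[OF V]] and Wv = subsetD[OF submod_subset[OF W]]
  define p where "p x = fst (THE q. fst q \<in> V \<and> snd q \<in> W \<and> x = vadd R n (fst q) (snd q))" for x
  \<comment> \<open>Uniqueness allows \<open>p\<close> to be evaluated from any decomposition;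
    linearity then follows by adding or scaling decompositions.\<close>
  have p_eq: "p (\<lambda>i. v i \<oplus> w i) = v" if vw: "v \<in> V" "w \<in> W" for v w
  proof -
    have e: "(\<lambda>i. v i \<oplus> w i) = vadd R n v w" using vadd_vecs Vv[OF vw(1)] Wv[OF vw(2)] by simp
    have "(\<lambda>i. v i \<oplus> w i) \<in> vecs R n" using vecs_add Vv[OF vw(1)] Wv[OF vw(2)] by simp
    from the1_equality[OF ex1[OF this], of "(v, w)"] e vw show ?thesis by (simp add: p_def)
  qed
  have dec: "\<exists>w\<in>W. p x \<in> V \<and> x = (\<lambda>i. p x i \<oplus> w i)" if x: "x \<in> vecs R n" for x
  proof -
    obtain q where q: "fst q \<in> V" "snd q \<in> W" "x = vadd R n (fst q) (snd q)" using ex1[OF x] by blast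
    then have xe: "x = (\<lambda>i. fst q i \<oplus> snd q i)" using vadd_vecs Vv Wv by simp
    then have "p x = fst q" using p_eq q by simp
    then show ?thesis using q(1) xe by (intro bexI[OF _ q(2)]) simp
  qed
  have "lin (vecs R n) n p"
    unfolding lin_def
  proof (intro conjI ballI)
    fix x assume "x \<in> vecs R n" then show "p x \<in> vecs R n" using dec Vv by blast
  next
    fix x y assume x: "x \<in> vecs R n" and y: "y \<in> vecs R n"
    obtain v where v: "v \<in> W" "p x \<in> V" "x = (\<lambda>i. p x i \<oplus> v i)" using dec[OF x] by blast
    obtain w where w: "w \<in> W" "p y \<in> V" "y = (\<lambda>i. p y i \<oplus> w i)" using dec[OF y] by blast
    have "x i \<oplus> y i = (p x i \<oplus> p y i) \<oplus> (v i \<oplus> w i)" for i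
    proof -
      have "(p x i \<oplus> v i) \<oplus> (p y i \<oplus> w i) = (p x i \<oplus> p y i) \<oplus> (v i \<oplus> w i)"
        using vecs_closed[OF Vv[OF v(2)], of i] vecs_closed[OF Vv[OF w(2)], of i]
          vecs_closed[OF Wv[OF v(1)], of i] vecs_closed[OF Wv[OF w(1)], of i] by algebra
      then show ?thesis using fun_cong[OF v(3), of i] fun_cong[OF w(3), of i] by simp
    qed
    then show "p (\<lambda>i. x i \<oplus> y i) = (\<lambda>i. p x i \<oplus> p y i)"
      using p_eq[OF submod_add[OF V v(2) w(2)] submod_add[OF W v(1) w(1)]] by simp
  next
    fix a x assume a: "a \<in> carrier R" and x: "x \<in> vecs R n"
    obtain v where v: "v \<in> W" "p x \<in> V" "x = (\<lambda>i. p x i \<oplus> v i)" using dec[OF x] by blast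
    have "a \<otimes> x i = a \<otimes> p x i \<oplus> a \<otimes> v i" for i
      using fun_cong[OF v(3), of i] a vecs_closed[OF Vv[OF v(2)], of i] vecs_closed[OF Wv[OF v(1)], of i]
        r_distr[of "p x i" "v i" a] by simp
    then show "p (\<lambda>i. a \<otimes> x i) = (\<lambda>i. a \<otimes> p x i)"
      using p_eq[OF submod_smult[OF V a v(2)] submod_smult[OF W a v(1)]] by simp
  qed
  moreover have "p x \<in> V" if "x \<in> vecs R n" for x using dec[OF that] by blast
  moreover have "p v = v" if "v \<in> V" for v
    using p_eq[OF that submod_zero[OF W]] vecs_closed[OF Vv[OF that]] by (simp add: vzero_def)
  ultimately show thesis using that by blast
qed

text \<open>The left inverse projects to \<open>V\<close> and then reads off coordinates with
  respect to \<open>f\<close>.\<close>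

lemma direct_summand_left_inverse:
  assumes "direct_summand R n V" and f: "lin (vecs R r) n f" "inj_on f (vecs R r)" "V = f ` vecs R r"
  obtains q where "lin (vecs R n) r q" "\<And>v. v \<in> vecs R r \<Longrightarrow> q (f v) = v"
proof -
  obtain p where p: "lin (vecs R n) n p" "\<And>x. x \<in> vecs R n \<Longrightarrow> p x \<in> V" "\<And>v. v \<in> V \<Longrightarrow> p v = v"
    using direct_summand_projection[OF assms(1)] by blast
  have "lin (vecs R n) r (\<lambda>x. inv_into (vecs R r) f (p x))"
    using lin_comp[OF p(1) _ lin_inv_into[OF f(1) submod_vecs[OF order_refl] f(2)]] p(2) f(3) by auto
  moreover have "inv_into (vecs R r) f (p (f v)) = v" if "v \<in> vecs R r" for v
    using p(3) f(2,3) that by simp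
  ultimately show thesis using that by blast
qed

text \<open>\<open>q\<close> identifies the quotient with R^m and \<open>f\<close> is a section. The
  classes of the \<open>f (unit_vec j)\<close> form a basis, and the coefficients of
  \<open>x\<close> are forced to be the entries of \<open>q x\<close>.\<close>

lemma free_quotientI:
  assumes f: "lin (vecs R m) n f" and q: "lin (vecs R n) m q"
    and qf: "\<And>y. y \<in> vecs R m \<Longrightarrow> q (f y) = y"
    and ker: "\<And>x. x \<in> vecs R n \<Longrightarrow> q x = vzero R \<longleftrightarrow> x \<in> V"
    and V: "submod R n V"
  shows "free_quotient R n V"
  unfolding free_quotient_def
proof (intro conjI exI ballI)
  let ?ws = "map (\<lambda>j. f (unit_vec j)) [0..<m]"
  show "submod R n V" by fact
  show "set ?ws \<subseteq> vecs R n" using lin_vecs[OF f unit_vec_vecs] by auto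
  fix x assume x: "x \<in> vecs R n"
  have qx: "q x \<in> vecs R m" using lin_vecs[OF q x] .
  have fqx: "f (q x) \<in> vecs R n" using lin_vecs[OF f qx] .
  show "\<exists>!cs. length cs = length ?ws \<and> set cs \<subseteq> carrier R \<and> (\<exists>v\<in>V. x = vadd R n v (lincomb R n cs ?ws))"
  proof (rule ex1I[of _ "map (q x) [0..<m]"])
    have cl: "set (map (q x) [0..<m]) \<subseteq> carrier R" using vecs_closed[OF qx] by auto
    then have lc: "lincomb R n (map (q x) [0..<m]) ?ws = f (q x)"
      using lincomb_lin_images[OF f, of "map (q x) [0..<m]"] by (simp add: list_vec_map[OF qx])
    note mm = lin_minus[OF q submod_vecs[OF order_refl] x fqx]
    have "q (\<lambda>i. x i \<ominus> f (q x) i) = vzero R"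
      unfolding mm(1) qf[OF qx] using vecs_closed[OF qx] by (simp add: vzero_def minus_eq r_neg)
    then have inV: "(\<lambda>i. x i \<ominus> f (q x) i) \<in> V" using ker[OF mm(2)] by simp
    have "x i = (x i \<ominus> f (q x) i) \<oplus> f (q x) i" for i
      using vecs_closed[OF x, of i] vecs_closed[OF fqx, of i] by algebra
    then have "x = vadd R n (\<lambda>i. x i \<ominus> f (q x) i) (f (q x))"
      using vadd_vecs[OF mm(2) fqx] by simp
    then show "length (map (q x) [0..<m]) = length ?ws \<and> set (map (q x) [0..<m]) \<subseteq> carrier R
        \<and> (\<exists>v\<in>V. x = vadd R n v (lincomb R n (map (q x) [0..<m]) ?ws))"
      using inV cl unfolding lc by auto
    fix cs assume cs: "length cs = length ?ws \<and> set cs \<subseteq> carrier R \<and> (\<exists>v\<in>V. x = vadd R n v (lincomb R n cs ?ws))"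
    then obtain v where v: "v \<in> V" "x = vadd R n v (f (list_vec cs))"
      using lincomb_lin_images[OF f, of cs] by auto
    have lv: "list_vec cs \<in> vecs R m" using cs list_vec_vecs[of cs] by simp
    have vv: "v \<in> vecs R n" using v submod_subset[OF V] by blast
    have "x = (\<lambda>i. v i \<oplus> f (list_vec cs) i)"
      using v(2) vadd_vecs[OF vv lin_vecs[OF f lv]] by simp
    then have "q x = (\<lambda>i. q v i \<oplus> q (f (list_vec cs)) i)"
      using lin_add[OF q vv lin_vecs[OF f lv]] by simp
    then have "q x = list_vec cs"
      using ker[OF vv] v(1) qf[OF lv] vecs_closed[OF lv] by (simp add: vzero_def)
    then show "cs = map (q x) [0..<m]"
      using cs qx by (intro list_vec_inject) (auto simp: list_vec_map)
  qed
qed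

end

section \<open>Completion of split injections and standard flags\<close>

context finite_cring
begin

text \<open>A kernel vector vanishes off \<open>k\<close> at once; then \<open>mu\<close> vanishes
  on it by \<open>indep\<close>, and so does its entry at \<open>k\<close>.\<close>

lemma lin_transvection_row:
  assumes k: "k < n" and mu: "\<And>x. x \<in> vecs R n \<Longrightarrow> mu x \<in> carrier R"
    "\<And>x y. x \<in> vecs R n \<Longrightarrow> y \<in> vecs R n \<Longrightarrow> mu (\<lambda>i. x i \<oplus> y i) = mu x \<oplus> mu y"
    "\<And>a x. a \<in> carrier R \<Longrightarrow> x \<in> vecs R n \<Longrightarrow> mu (\<lambda>i. a \<otimes> x i) = a \<otimes> mu x"
    and indep: "\<And>x. x \<in> vecs R n \<Longrightarrow> (\<And>i. i \<noteq> k \<Longrightarrow> x i = \<zero>) \<Longrightarrow> mu x = \<zero>"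
  shows "lin (vecs R n) n (\<lambda>x i. if i = k then x k \<oplus> mu x else x i)" (is "lin _ _ ?B")
    and "inj_on (\<lambda>x i. if i = k then x k \<oplus> mu x else x i) (vecs R n)"
proof -
  show B: "lin (vecs R n) n ?B"
    unfolding lin_def
  proof (intro conjI ballI ext)
    fix x assume x: "x \<in> vecs R n"
    show "?B x \<in> vecs R n" using x mu(1)[OF x] k vecs_closed[OF x] by (auto simp: vecs_def)
  next
    fix x y i assume x: "x \<in> vecs R n" and y: "y \<in> vecs R n"
    have "(x k \<oplus> y k) \<oplus> (mu x \<oplus> mu y) = (x k \<oplus> mu x) \<oplus> (y k \<oplus> mu y)"
      using vecs_closed[OF x, of k] vecs_closed[OF y, of k] mu(1)[OF x] mu(1)[OF y] by algebra
    then show "?B (\<lambda>i. x i \<oplus> y i) i = ?B x i \<oplus> ?B y i" using mu(2)[OF x y] by simp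
  next
    fix a x i assume a: "a \<in> carrier R" and x: "x \<in> vecs R n"
    show "?B (\<lambda>i. a \<otimes> x i) i = a \<otimes> ?B x i"
      using mu(3)[OF a x] a vecs_closed[OF x, of k] mu(1)[OF x] by (simp add: r_distr)
  qed
  show "inj_on ?B (vecs R n)"
  proof (rule lin_inj_onI[OF B submod_vecs[OF order_refl]])
    fix x assume x: "x \<in> vecs R n" and z: "?B x = vzero R"
    have off: "x i = \<zero>" if "i \<noteq> k" for i using fun_cong[OF z, of i] that by (simp add: vzero_def)
    then have "mu x = \<zero>" using indep[OF x] by blast
    then have "x k = \<zero>" using fun_cong[OF z, of k] vecs_closed[OF x] by (simp add: vzero_def)
    with off have "x i = \<zero>" for i by (cases "i = k") simp_all
    then show "x = vzero R" by (simp add: vzero_def fun_eq_iff)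
  qed
qed

text \<open>The entry at \<open>k\<close> is multiplied by the unit 1 + w k. A kernel vector
  therefore has \<open>x k\<close> zero, after which the added multiple of \<open>w\<close>
  disappears.\<close>

lemma lin_transvection_column:
  assumes w: "w \<in> vecs R n" and u: "u \<in> carrier R" "u \<otimes> (\<one> \<oplus> w k) = \<one>"
  shows "lin (vecs R n) n (\<lambda>x i. x i \<oplus> x k \<otimes> w i)" (is "lin _ _ ?B")
    and "inj_on (\<lambda>x i. x i \<oplus> x k \<otimes> w i) (vecs R n)"
proof -
  note wc = vecs_closed[OF w]
  show B: "lin (vecs R n) n ?B"
    unfolding lin_def
  proof (intro conjI ballI ext)
    fix x assume x: "x \<in> vecs R n"
    show "?B x \<in> vecs R n" using x w vecs_closed[OF x] by (auto simp: vecs_def)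
  next
    fix x y i assume x: "x \<in> vecs R n" and y: "y \<in> vecs R n"
    show "?B (\<lambda>i. x i \<oplus> y i) i = ?B x i \<oplus> ?B y i"
      using vecs_closed[OF x, of k] vecs_closed[OF y, of k] vecs_closed[OF x, of i] vecs_closed[OF y, of i]
        wc[of i] by algebra
  next
    fix a x i assume a: "a \<in> carrier R" and x: "x \<in> vecs R n"
    show "?B (\<lambda>i. a \<otimes> x i) i = a \<otimes> ?B x i"
      using a vecs_closed[OF x, of k] vecs_closed[OF x, of i] wc[of i] by algebra
  qed
  show "inj_on ?B (vecs R n)"
  proof (rule lin_inj_onI[OF B submod_vecs[OF order_refl]])
    fix x assume x: "x \<in> vecs R n" and z: "?B x = vzero R"
    note xc = vecs_closed[OF x]
    have "x k = (u \<otimes> (\<one> \<oplus> w k)) \<otimes> x k" using u xc by simp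
    also have "\<dots> = u \<otimes> (x k \<oplus> x k \<otimes> w k)" using u(1) xc[of k] wc[of k] by algebra
    also have "\<dots> = \<zero>" using fun_cong[OF z, of k] u(1) by (simp add: vzero_def)
    finally have xk: "x k = \<zero>" .
    have "x i = \<zero>" for i using fun_cong[OF z, of i] xk xc wc by (simp add: vzero_def)
    then show "x = vzero R" by (simp add: vzero_def fun_eq_iff)
  qed
qed

lemma lin_inj_comp:
  assumes "lin (vecs R n) n A" "inj_on A (vecs R n)" "lin (vecs R n) n B" "inj_on B (vecs R n)"
  shows "lin (vecs R n) n (\<lambda>x. B (A x))" "inj_on (\<lambda>x. B (A x)) (vecs R n)"
proof -
  note im = lin_inj_imp_image[OF assms(1,2)]
  show "lin (vecs R n) n (\<lambda>x. B (A x))" using lin_comp[OF assms(1) _ assms(3)] im by simp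
  show "inj_on (\<lambda>x. B (A x)) (vecs R n)"
    using comp_inj_on[OF assms(2), of B] assms(4) im by (simp add: o_def)
qed

text \<open>Stable range one turns a unimodular tail of \<open>v\<close> into a unit in position \<open>k\<close> by one row
  operation; that unit then clears the column.\<close>

lemma clear_column:
  assumes k: "k < n" and v: "v \<in> vecs R n" and l: "\<And>i. l i \<in> carrier R"
    and unimodular: "finsum R (\<lambda>i. v i \<otimes> l i) {..<n} = \<one>" and low: "\<And>i. i < k \<Longrightarrow> l i = \<zero>"
  shows "\<exists>B. lin (vecs R n) n B \<and> inj_on B (vecs R n) \<and> B v = unit_vec k \<and> (\<forall>j<k. B (unit_vec j) = unit_vec j)"
proof -
  \<comment> \<open>The functional \<open>l\<close> with its entry at \<open>k\<close> removed, so
    that \<open>m\<close> does not see coordinate \<open>k\<close>, as a row operation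
    requires.\<close>
  define m where "m = (\<lambda>x :: nat \<Rightarrow> 'a. finsum R (\<lambda>i. x i \<otimes> (if i = k then \<zero> else l i)) {..<n})"
  have l': "(if i = k then \<zero> else l i) \<in> carrier R" for i using l by simp
  \<comment> \<open>Regards \<open>m\<close> as a linear map to R^1, whose only coordinate has index
    0, to inherit additivity and homogeneity.\<close>
  have m_col: "lin (vecs R n) 1 (\<lambda>x i. finsum R (\<lambda>j. x j \<otimes> (if i = 0 then (if j = k then \<zero> else l j) else \<zero>)) {..<n})"
    by (rule lin_columns) (use l in \<open>auto simp: vecs_def\<close>)
  have mc: "m x \<in> carrier R" if "x \<in> vecs R n" for x
    unfolding m_def using vecs_closed[OF that] l' by (intro finsum_closed) auto
  have ma: "m (\<lambda>i. x i \<oplus> y i) = m x \<oplus> m y" if "x \<in> vecs R n" "y \<in> vecs R n" for x y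
    using fun_cong[OF lin_add[OF m_col that], of 0] by (simp add: m_def)
  have ms: "m (\<lambda>i. a \<otimes> x i) = a \<otimes> m x" if "a \<in> carrier R" "x \<in> vecs R n" for a x
    using fun_cong[OF lin_smult[OF m_col that], of 0] by (simp add: m_def)
  \<comment> \<open>Holds because \<open>l\<close> vanishes below \<open>k\<close> and its entry at
    \<open>k\<close> was removed. It gives both the independence condition of the row operation and
    the fact that this operation fixes the earlier unit vectors.\<close>
  have mz: "m x = \<zero>" if x: "x \<in> vecs R n" and xz: "\<And>i. i < n \<Longrightarrow> k < i \<Longrightarrow> x i = \<zero>" for x
  proof -
    have "x i \<otimes> (if i = k then \<zero> else l i) = \<zero>" if "i < n" for i
      using vecs_closed[OF x, of i] l[of i] low[of i] xz[OF that] by (cases i k rule: linorder_cases) auto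
    then have "m x = finsum R (\<lambda>i. \<zero>) {..<n}"
      unfolding m_def by (intro finsum_cong') auto
    then show ?thesis by simp
  qed
  have vc: "v i \<in> carrier R" for i using vecs_closed[OF v] .
  have "finsum R (\<lambda>i. v i \<otimes> l i) {..<n}
      = finsum R (\<lambda>i. (if k = i then v i \<otimes> l i else \<zero>) \<oplus> v i \<otimes> (if i = k then \<zero> else l i)) {..<n}"
    using vc l by (intro finsum_cong') auto
  also have "\<dots> = finsum R (\<lambda>i. if k = i then v i \<otimes> l i else \<zero>) {..<n} \<oplus> m v"
    unfolding m_def using vc l by (intro finsum_addf) auto
  also have "finsum R (\<lambda>i. if k = i then v i \<otimes> l i else \<zero>) {..<n} = v k \<otimes> l k"
    using vc l k by (intro finsum_singleton) auto
  \<comment> \<open>Unimodularity in the form used by stable range one, with \<open>v k\<close> as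
    first and \<open>m v\<close> as second element.\<close>
  finally have "l k \<otimes> v k \<oplus> m v = \<one>" using unimodular vc l by (simp add: m_comm)
  then obtain s u where s: "s \<in> carrier R" and u: "u \<in> carrier R" "(v k \<oplus> s \<otimes> m v) \<otimes> u = \<one>"
    using stable_range_one[OF vc mc[OF v] l] by blast
  define t where "t = v k \<oplus> s \<otimes> m v"
  have t: "t \<in> carrier R" using vc s mc[OF v] by (simp add: t_def)
  have tu: "t \<otimes> u = \<one>" using u(2) by (simp add: t_def)
  define B1 where "B1 = (\<lambda>x i. if i = k then x k \<oplus> s \<otimes> m x else x i)"
  have B1: "lin (vecs R n) n B1" "inj_on B1 (vecs R n)"
    unfolding B1_def
    by (rule lin_transvection_row[OF k]; use s in \<open>auto simp: mc ma ms r_distr m_lcomm mz\<close>)+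
  define v' where "v' = B1 v"
  have v': "v' \<in> vecs R n" "v' k = t" using lin_vecs[OF B1(1) v] by (auto simp: v'_def B1_def t_def)
  \<comment> \<open>Chosen so that v' + t w is the unit vector at \<open>k\<close>, because t u = 1.
    Then 1 + w k equals \<open>u\<close>, whose inverse is \<open>t\<close>.\<close>
  define w where "w = (\<lambda>i. u \<otimes> (unit_vec k i \<ominus> v' i))"
  have w: "w \<in> vecs R n"
    using vecs_smult[OF u(1) lin_minus(2)[OF lin_id[OF order_refl] submod_vecs[OF order_refl] unit_vec_vecs[OF k] v'(1)]]
    by (simp add: w_def)
  have "t \<otimes> (\<one> \<oplus> w k) = \<one>"
  proof -
    have "t \<otimes> (\<one> \<oplus> u \<otimes> (\<one> \<ominus> t)) = t \<oplus> t \<otimes> u \<otimes> (\<one> \<ominus> t)" using t u(1) by algebra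
    also have "\<dots> = \<one>" unfolding tu using t by algebra
    finally show ?thesis by (simp add: w_def unit_vec_def v')
  qed
  note B2 = lin_transvection_column[OF w t this]
  have B2v: "(\<lambda>i. v' i \<oplus> v' k \<otimes> w i) = unit_vec k"
  proof
    fix i
    have uc: "unit_vec k i \<in> carrier R" by (simp add: unit_vec_def)
    have "v' i \<oplus> t \<otimes> (u \<otimes> (unit_vec k i \<ominus> v' i)) = v' i \<oplus> t \<otimes> u \<otimes> (unit_vec k i \<ominus> v' i)"
      using t u(1) vecs_closed[OF v'(1), of i] uc by algebra
    also have "\<dots> = unit_vec k i" unfolding tu using vecs_closed[OF v'(1), of i] uc by algebra
    finally show "v' i \<oplus> v' k \<otimes> w i = unit_vec k i" by (simp add: w_def v')
  qed
  have B1e: "B1 (unit_vec j) = unit_vec j" if "j < k" for j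
  proof -
    have j: "unit_vec j \<in> vecs R n" using that k by (intro unit_vec_vecs) simp
    then have "m (unit_vec j) = \<zero>" using that by (intro mz) (auto simp: unit_vec_def)
    then show ?thesis using s by (auto simp: B1_def unit_vec_def fun_eq_iff)
  qed
  have B2e: "(\<lambda>i. unit_vec j i \<oplus> unit_vec j k \<otimes> w i) = unit_vec j" if "j < k" for j
    using that vecs_closed[OF w] by (auto simp: unit_vec_def fun_eq_iff)
  have "lin (vecs R n) n (\<lambda>x i. B1 x i \<oplus> B1 x k \<otimes> w i)" "inj_on (\<lambda>x i. B1 x i \<oplus> B1 x k \<otimes> w i) (vecs R n)"
    using lin_inj_comp[OF B1 B2] by simp_all
  moreover have "(\<lambda>i. B1 v i \<oplus> B1 v k \<otimes> w i) = unit_vec k" using B2v by (simp add: v'_def)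
  moreover have "(\<lambda>i. B1 (unit_vec j) i \<oplus> B1 (unit_vec j) k \<otimes> w i) = unit_vec j" if "j < k" for j
    using B1e[OF that] B2e[OF that] by simp
  ultimately show ?thesis
    by (intro exI[of _ "\<lambda>x i. B1 x i \<oplus> B1 x k \<otimes> w i"]) simp
qed

text \<open>The columns of \<open>f\<close> are normalised one at a time. The left inverse
  \<open>q\<close>, precomposed with the inverse of the automorphism built so far, supplies the
  unimodular relation for the next column, with zero coefficients at the positions already
  settled.\<close>

lemma split_injection_completion:
  assumes rn: "r \<le> n" and f: "lin (vecs R r) n f" and q: "lin (vecs R n) r q"
    and qf: "\<And>v. v \<in> vecs R r \<Longrightarrow> q (f v) = v"
  shows "\<exists>A. lin (vecs R n) n A \<and> inj_on A (vecs R n) \<and> (\<forall>v\<in>vecs R r. A (f v) = v)"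
proof -
  have "\<exists>A. lin (vecs R n) n A \<and> inj_on A (vecs R n) \<and> (\<forall>j<k. A (f (unit_vec j)) = unit_vec j)" if "k \<le> r" for k
    using that
  proof (induction k)
    case 0
    show ?case using lin_id[OF order_refl] by (intro exI[of _ "\<lambda>x. x"]) simp
  next
    case (Suc k)
    then obtain A where A: "lin (vecs R n) n A" "inj_on A (vecs R n)"
      and Ae: "\<And>j. j < k \<Longrightarrow> A (f (unit_vec j)) = unit_vec j" by auto
    note im = lin_inj_imp_image[OF A]
    define A' where "A' = inv_into (vecs R n) A"
    have A': "lin (vecs R n) n A'"
      using lin_inv_into[OF A(1) submod_vecs[OF order_refl] A(2)] by (simp add: A'_def im)
    have A'A: "A' (A x) = x" if "x \<in> vecs R n" for x using A(2) that by (simp add: A'_def)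
    have qA': "lin (vecs R n) r (\<lambda>x. q (A' x))"
      by (rule lin_comp[OF A' _ q]) (use lin_vecs[OF A'] in blast)
    have ek: "unit_vec k \<in> vecs R r" using Suc.prems by (simp add: unit_vec_vecs)
    define v where "v = A (f (unit_vec k))"
    have fk: "f (unit_vec j) \<in> vecs R n" if "j < r" for j using lin_vecs[OF f unit_vec_vecs[OF that]] .
    have v: "v \<in> vecs R n" using lin_vecs[OF A(1) fk] Suc.prems by (simp add: v_def)
    \<comment> \<open>Row \<open>k\<close> of the left inverse, in the coordinates after applying
      \<open>A\<close>.\<close>
    define l where "l i = (if i < n then q (A' (unit_vec i)) k else \<zero>)" for i
    have lc: "l i \<in> carrier R" for i
      using vecs_closed[OF lin_vecs[OF qA' unit_vec_vecs]] by (simp add: l_def)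
    have "\<one> = q (A' v) k"
      using A'A[OF fk] qf[OF ek] Suc.prems by (simp add: v_def unit_vec_def)
    also have "\<dots> = finsum R (\<lambda>i. v i \<otimes> q (A' (unit_vec i)) k) {..<n}"
      by (rule lin_expand[OF qA' v])
    also have "\<dots> = finsum R (\<lambda>i. v i \<otimes> l i) {..<n}"
      using vecs_closed[OF v] lc by (intro finsum_cong') (auto simp: l_def)
    finally have uni: "finsum R (\<lambda>i. v i \<otimes> l i) {..<n} = \<one>" by simp
    \<comment> \<open>\<open>A'\<close> takes an earlier unit vector back to its column of
      \<open>f\<close>, and \<open>q\<close> returns the unit vector, whose entry at
      \<open>k\<close> is zero.\<close>
    have low: "l j = \<zero>" if "j < k" for j
    proof -
      have "A' (unit_vec j) = f (unit_vec j)" using Ae[OF that] A'A[OF fk, of j] that Suc.prems by simp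
      then have "q (A' (unit_vec j)) = unit_vec j" using qf[OF unit_vec_vecs, of j] that Suc.prems by simp
      then show ?thesis using that by (simp add: l_def unit_vec_def)
    qed
    obtain B where B: "lin (vecs R n) n B" "inj_on B (vecs R n)" "B v = unit_vec k"
      "\<And>j. j < k \<Longrightarrow> B (unit_vec j) = unit_vec j"
      using clear_column[of k n v l, OF _ v lc uni low] Suc.prems rn by auto
    have "B (A (f (unit_vec j))) = unit_vec j" if "j < Suc k" for j
      using that B(3,4) Ae by (cases "j = k") (auto simp: v_def)
    then show ?case using lin_inj_comp[OF A B(1,2)] by (intro exI[of _ "\<lambda>x. B (A x)"]) blast
  qed
  from this[of r] obtain A where A: "lin (vecs R n) n A" "inj_on A (vecs R n)"
    and Ae: "\<And>j. j < r \<Longrightarrow> A (f (unit_vec j)) = unit_vec j" by auto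
  have "A (f v) = v" if "v \<in> vecs R r" for v
  proof (rule lin_eq_on_unit_vecs[OF _ lin_id[OF order_refl] that])
    show "lin (vecs R r) n (\<lambda>v. A (f v))"
      by (rule lin_comp[OF f _ A(1)]) (use lin_vecs[OF f] in blast)
  qed (rule Ae)
  then show ?thesis using A by blast
qed

end

text \<open>Counting from the left end bounds \<open>k i\<close> from below, counting up to the
  right end bounds it from above. This pins the ranks in a complete flag.\<close>

lemma strict_chain_ranks:
  fixes k :: "nat \<Rightarrow> nat"
  assumes mono: "\<And>i j. i < j \<Longrightarrow> j < m \<Longrightarrow> k i < k j" and bds: "\<And>i. i < m \<Longrightarrow> 0 < k i \<and> k i \<le> m"
    and i: "i < m"
  shows "k i = Suc i"
proof (rule antisym)
  show "Suc i \<le> k i"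
    using i
  proof (induction i)
    case 0
    then show ?case using bds[of 0] by simp
  next
    case (Suc i)
    then show ?case using mono[of i "Suc i"] by simp
  qed
  have "k i + d \<le> k (i + d)" if "i + d < m" for d
    using that
  proof (induction d)
    case (Suc d)
    then show ?case using mono[of "i + d" "i + Suc d"] by simp
  qed simp
  from this[of "m - 1 - i"] bds[of "m - 1"] i
  have "k i + (m - 1 - i) \<le> m" by simp
  then show "k i \<le> Suc i" using i by arith
qed

lemma subseq_upt_sorted: "subseq rs [a..<b] \<Longrightarrow> sorted_wrt (<) rs \<and> set rs \<subseteq> {a..<b}"
proof -
  assume "subseq rs [a..<b]"
  then obtain N where N: "rs = nths [a..<b] N" by (auto simp: subseq_conv_nths)
  have "distinct rs" "sorted rs" unfolding N by (simp_all add: sorted_nths)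
  then have "sorted_wrt (<) rs" by (simp add: strict_sorted_iff)
  moreover have "set rs \<subseteq> {a..<b}" unfolding N using set_nths_subset[of "[a..<b]" N] by simp
  ultimately show ?thesis by blast
qed

section \<open>Translates of the standard flag by invertible matrices\<close>

context finite_cring
begin

lemma GL_inj_on_vecs: "g \<in> GL R n \<Longrightarrow> r \<le> n \<Longrightarrow> inj_on (mat_vec R n g) (vecs R r)"
  using inj_on_subset[OF _ vecs_mono] GL_iff by blast

lemma lin_GL_vecs: "g \<in> GL R n \<Longrightarrow> r \<le> n \<Longrightarrow> lin (vecs R r) n (mat_vec R n g)"
  using lin_subset[OF lin_mat_vec vecs_mono] GL_mats by blast

lemma card_GL_image: "g \<in> GL R n \<Longrightarrow> r \<le> n \<Longrightarrow> card (mat_vec R n g ` vecs R r) = card (carrier R) ^ r"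
  by (simp add: card_image GL_inj_on_vecs card_vecs)

lemma free_submod_GL_image: "g \<in> GL R n \<Longrightarrow> r \<le> n \<Longrightarrow> free_submod R n (mat_vec R n g ` vecs R r)"
  by (intro free_submodI lin_GL_vecs GL_inj_on_vecs)

lemma submod_GL_image: "g \<in> GL R n \<Longrightarrow> r \<le> n \<Longrightarrow> submod R n (mat_vec R n g ` vecs R r)"
  using submod_image[OF lin_GL_vecs submod_vecs[OF order_refl]] by blast

text \<open>Truncation to the first \<open>r\<close> coordinates, conjugated by \<open>g\<close>, is
  the required projection.\<close>

lemma direct_summand_GL_image:
  assumes g: "g \<in> GL R n" and r: "r \<le> n"
  shows "direct_summand R n (mat_vec R n g ` vecs R r)"
proof -
  obtain h where h: "h \<in> GL R n"
    and gh: "\<And>v. v \<in> vecs R n \<Longrightarrow> mat_vec R n g (mat_vec R n h v) = v \<and> mat_vec R n h (mat_vec R n g v) = v"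
    using GL_inverse[OF g] by blast
  let ?t = "\<lambda>(x :: nat \<Rightarrow> 'a) i. if i < r then x i else \<zero>"
  have t: "lin (vecs R n) n ?t"
    using r unfolding lin_def vecs_def by (auto simp: fun_eq_iff)
  have tr: "?t x \<in> vecs R r" if "x \<in> vecs R n" for x using that r by (auto simp: vecs_def)
  have t_id: "?t x = x" if "x \<in> vecs R r" for x using that by (auto simp: vecs_def fun_eq_iff)
  have hv: "mat_vec R n h x \<in> vecs R n" if "x \<in> vecs R n" for x using mat_vec_vecs[OF GL_mats[OF h] that] .
  have th: "lin (vecs R n) n (\<lambda>x. ?t (mat_vec R n h x))"
    by (rule lin_comp[OF lin_mat_vec[OF GL_mats[OF h]] _ t]) (use hv in blast)
  have "lin (vecs R n) n (\<lambda>x. mat_vec R n g (?t (mat_vec R n h x)))"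
    by (rule lin_comp[OF th _ lin_mat_vec[OF GL_mats[OF g]]]) (use lin_vecs[OF th] in blast)
  then show ?thesis
  proof (rule direct_summandI)
    show "mat_vec R n g (?t (mat_vec R n h x)) \<in> mat_vec R n g ` vecs R r" if "x \<in> vecs R n" for x
      using tr[OF hv[OF that]] by blast
    show "mat_vec R n g (?t (mat_vec R n h v)) = v" if v: "v \<in> mat_vec R n g ` vecs R r" for v
    proof -
      obtain y where y: "y \<in> vecs R r" "v = mat_vec R n g y" using v by blast
      then have hv_eq: "mat_vec R n h v = y" using gh vecs_mono[OF r] by auto
      show ?thesis unfolding hv_eq t_id[OF y(1)] by (rule y(2)[symmetric])
    qed
  qed (rule submod_GL_image[OF g r])
qed

text \<open>Applying the inverse of \<open>g\<close> and dropping the first \<open>r\<close>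
  coordinates has the translate as kernel; shifting up by \<open>r\<close> and applying
  \<open>g\<close> is a section.\<close>

lemma free_quotient_GL_image:
  assumes g: "g \<in> GL R n" and r: "r \<le> n"
  shows "free_quotient R n (mat_vec R n g ` vecs R r)"
proof -
  obtain h where h: "h \<in> GL R n"
    and gh: "\<And>v. v \<in> vecs R n \<Longrightarrow> mat_vec R n g (mat_vec R n h v) = v \<and> mat_vec R n h (mat_vec R n g v) = v"
    using GL_inverse[OF g] by blast
  let ?s = "\<lambda>(y :: nat \<Rightarrow> 'a) i. if i < r then \<zero> else y (i - r)"
  let ?d = "\<lambda>(x :: nat \<Rightarrow> 'a) j. x (r + j)"
  have s: "lin (vecs R (n - r)) n ?s"
    using r unfolding lin_def vecs_def by (auto simp: fun_eq_iff)
  have d: "lin (vecs R n) (n - r) ?d"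
    using r unfolding lin_def vecs_def by (auto simp: fun_eq_iff)
  have hv: "mat_vec R n h x \<in> vecs R n" if "x \<in> vecs R n" for x using mat_vec_vecs[OF GL_mats[OF h] that] .
  have d0: "?d x = vzero R \<longleftrightarrow> x \<in> vecs R r" if x: "x \<in> vecs R n" for x
  proof
    assume z: "?d x = vzero R"
    have "x i = \<zero>" if "r \<le> i" for i
      using fun_cong[OF z, of "i - r"] that by (simp add: vzero_def)
    then show "x \<in> vecs R r" using vecs_closed[OF x] by (auto simp: vecs_def)
  qed (auto simp: vecs_def vzero_def)
  show ?thesis
  proof (rule free_quotientI)
    show "lin (vecs R (n - r)) n (\<lambda>y. mat_vec R n g (?s y))"
      by (rule lin_comp[OF s _ lin_mat_vec[OF GL_mats[OF g]]]) (use lin_vecs[OF s] in blast)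
    show "lin (vecs R n) (n - r) (\<lambda>x. ?d (mat_vec R n h x))"
      by (rule lin_comp[OF lin_mat_vec[OF GL_mats[OF h]] _ d]) (use hv in blast)
    show "?d (mat_vec R n h (mat_vec R n g (?s y))) = y" if "y \<in> vecs R (n - r)" for y
      using gh[OF lin_vecs[OF s that]] by simp
    show "?d (mat_vec R n h x) = vzero R \<longleftrightarrow> x \<in> mat_vec R n g ` vecs R r" if x: "x \<in> vecs R n" for x
    proof -
      have "mat_vec R n h x \<in> vecs R r \<longleftrightarrow> x \<in> mat_vec R n g ` vecs R r"
      proof
        assume "mat_vec R n h x \<in> vecs R r"
        then have "mat_vec R n g (mat_vec R n h x) \<in> mat_vec R n g ` vecs R r" by (rule imageI)
        then show "x \<in> mat_vec R n g ` vecs R r" using gh[OF x] by simp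
      next
        assume "x \<in> mat_vec R n g ` vecs R r"
        then obtain y where y: "y \<in> vecs R r" "x = mat_vec R n g y" by blast
        then show "mat_vec R n h x \<in> vecs R r" using gh vecs_mono[OF r] by auto
      qed
      then show ?thesis using d0[OF hv[OF x]] by simp
    qed
  qed (rule submod_GL_image[OF g r])
qed

lemma vecs_0: "vecs R 0 = {vzero R}"
  by (auto simp: vecs_def vzero_def fun_eq_iff)

text \<open>Over the zero ring all sets \<open>vecs R r\<close> coincide, so strict inclusions
  between translates require that 1 and 0 differ; \<open>simplices_trivial\<close> covers the other
  case.\<close>

context
  assumes nontrivial: "\<one> \<noteq> \<zero>"
begin

lemma card_carrier_gt_1: "card (carrier R) > 1"
proof -
  have "card {\<zero>, \<one>} \<le> card (carrier R)" by (rule card_mono[OF finite_carrier]) auto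
  then show ?thesis using nontrivial by simp
qed

lemma card_power_less_iff: "card (carrier R) ^ r < card (carrier R) ^ s \<longleftrightarrow> r < s"
  using card_carrier_gt_1 by (rule power_strict_increasing_iff)

lemma tits_vertex_GL_image:
  assumes g: "g \<in> GL R n" and r: "0 < r" "r < n"
  shows "tits_vertex R n (mat_vec R n g ` vecs R r)"
proof -
  have c: "card (mat_vec R n g ` vecs R r) = card (carrier R) ^ r" using g r by (simp add: card_GL_image)
  have "mat_vec R n g ` vecs R r \<noteq> {vzero R}"
  proof
    assume "mat_vec R n g ` vecs R r = {vzero R}"
    then have "card (carrier R) ^ r = card (carrier R) ^ 0" using c by simp
    then show False using card_power_less_iff[of 0 r] r by simp
  qed
  moreover have "mat_vec R n g ` vecs R r \<noteq> vecs R n"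
  proof
    assume "mat_vec R n g ` vecs R r = vecs R n"
    then have "card (carrier R) ^ r = card (carrier R) ^ n" using c by (simp add: card_vecs)
    then show False using card_power_less_iff[of r n] r by simp
  qed
  ultimately show ?thesis
    using g r by (simp add: tits_vertex_def direct_summand_GL_image free_submod_GL_image free_quotient_GL_image)
qed

lemma GL_image_psubset:
  assumes g: "g \<in> GL R n" and "r < s" "s \<le> n"
  shows "mat_vec R n g ` vecs R r \<subset> mat_vec R n g ` vecs R s"
proof -
  have "mat_vec R n g ` vecs R r \<subseteq> mat_vec R n g ` vecs R s"
    using assms vecs_mono[of r s] by (intro image_mono) simp
  moreover have "card (mat_vec R n g ` vecs R r) < card (mat_vec R n g ` vecs R s)"
    using assms by (simp add: card_GL_image card_power_less_iff)
  then have "mat_vec R n g ` vecs R r \<noteq> mat_vec R n g ` vecs R s" by (intro notI) simp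
  ultimately show ?thesis by (intro psubsetI)
qed

lemma flag_GL_image:
  assumes g: "g \<in> GL R n" and rs: "sorted_wrt (<) rs" "set rs \<subseteq> {1..<n}"
  shows "flag R n (map (\<lambda>r. mat_vec R n g ` vecs R r) rs)"
proof -
  have "sorted_wrt (\<lambda>r s. mat_vec R n g ` vecs R r \<subset> mat_vec R n g ` vecs R s) rs"
    by (rule sorted_wrt_mono_rel[OF _ rs(1)]) (use rs(2) in \<open>auto intro!: GL_image_psubset[OF g]\<close>)
  moreover have "tits_vertex R n (mat_vec R n g ` vecs R r)" if "r \<in> set rs" for r
    using that rs(2) by (intro tits_vertex_GL_image[OF g]) auto
  ultimately show ?thesis by (auto simp: flag_def sorted_wrt_map tits_vertex_def)
qed

text \<open>A basis of each member is extended to a basis of the next. The member of rank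
  \<open>k\<close> is a summand of R^n, so its inclusion in the next one splits; in coordinates this
  is a split injection of R^k into R^(k+1), which can be completed.\<close>

lemma complete_flag_eq_GL_image:
  assumes n: "n \<ge> 1" and G: "complete_flag R n G"
  shows "\<exists>g\<in>GL R n. G = map (\<lambda>r. mat_vec R n g ` vecs R r) [1..<n]"
proof -
  have len: "length G = n - 1" and chain: "sorted_wrt (\<subset>) G"
    and mem: "\<And>i. i < n - 1 \<Longrightarrow> direct_summand R n (G ! i) \<and> free_submod R n (G ! i) \<and>
      G ! i \<noteq> {vzero R} \<and> G ! i \<noteq> vecs R n"
    using G by (auto simp: complete_flag_def flag_def)
  have "\<exists>r f. lin (vecs R r) n f \<and> inj_on f (vecs R r) \<and> G ! i = f ` vecs R r" if i: "i < n - 1" for i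
    by (rule free_submodE[of n "G ! i"]) (use mem[OF i] in auto)
  then obtain rk where rk: "\<And>i. i < n - 1 \<Longrightarrow>
      \<exists>f. lin (vecs R (rk i)) n f \<and> inj_on f (vecs R (rk i)) \<and> G ! i = f ` vecs R (rk i)"
    by metis
  have sub: "G ! i \<subseteq> vecs R n" if "i < n - 1" for i
    using mem[OF that] by (auto simp: direct_summand_def submod_def)
  have fin: "finite (G ! i)" if "i < n - 1" for i using sub[OF that] finite_vecs finite_subset by blast
  have crd: "card (G ! i) = card (carrier R) ^ rk i" if "i < n - 1" for i
    using rk[OF that] by (auto simp: card_image card_vecs)
  \<comment> \<open>Cardinalities turn strict inclusions into strict inequalities of ranks, and
    \<open>n - 1\<close> increasing ranks between 1 and \<open>n - 1\<close> leave no
    choice.\<close>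
  have rk_eq: "rk i = Suc i" if i: "i < n - 1" for i
  proof (rule strict_chain_ranks[OF _ _ i])
    fix i j assume ij: "i < j" "j < n - 1"
    then have "G ! i \<subset> G ! j" using chain len by (simp add: sorted_wrt_nth_less)
    then have "card (G ! i) < card (G ! j)" using fin[OF ij(2)] by (rule psubset_card_mono[rotated])
    then show "rk i < rk j" using crd ij by (simp add: card_power_less_iff)
  next
    fix i assume i: "i < n - 1"
    have "G ! i \<subset> vecs R n" using sub[OF i] mem[OF i] by blast
    then have "card (G ! i) < card (vecs R n)" by (rule psubset_card_mono[OF finite_vecs])
    then have "rk i < n" using crd[OF i] by (simp add: card_vecs card_power_less_iff)
    moreover have "rk i \<noteq> 0"
    proof
      assume "rk i = 0"
      then obtain f where "lin {vzero R} n f" "G ! i = f ` {vzero R}" using rk[OF i] vecs_0 by auto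
      then have "G ! i = {vzero R}" using lin_zero[of "{vzero R}" n f] by simp
      then show False using mem[OF i] by blast
    qed
    ultimately show "0 < rk i \<and> rk i \<le> n - 1" by simp
  qed
  \<comment> \<open>Reindexes by rank: \<open>G ! (j - 1)\<close> has rank \<open>j\<close>. Adding
    R^n as last member lets the induction end with an automorphism of R^n.\<close>
  define V where "V j = (if j = n then vecs R n else G ! (j - 1))" for j
  have V: "direct_summand R n (V j) \<and> (\<exists>f. lin (vecs R j) n f \<and> inj_on f (vecs R j) \<and> V j = f ` vecs R j)"
    if j: "1 \<le> j" "j \<le> n" for j
  proof (cases "j = n")
    case True
    have "direct_summand R n (vecs R n)"
      by (rule direct_summandI[OF lin_id[OF order_refl]]) (auto simp: submod_vecs)
    moreover have "lin (vecs R n) n (\<lambda>v. v) \<and> inj_on (\<lambda>v. v) (vecs R n) \<and> vecs R n = (\<lambda>v. v) ` vecs R n"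
      using lin_id[OF order_refl] by auto
    ultimately show ?thesis using True unfolding V_def by (simp only: if_True simp_thms) (rule exI)
  next
    case False
    then have j1: "j - 1 < n - 1" "Suc (j - 1) = j" using j by auto
    then show ?thesis using mem[OF j1(1)] rk[OF j1(1)] rk_eq[OF j1(1)] False unfolding V_def by simp
  qed
  have Vmono: "V k \<subseteq> V (Suc k)" if "1 \<le> k" "Suc k \<le> n" for k
  proof (cases "Suc k = n")
    case True
    then show ?thesis using sub[of "k - 1"] that by (simp add: V_def)
  next
    case False
    then have "G ! (k - 1) \<subset> G ! k" using len that by (intro sorted_wrt_nth_less[OF chain]) auto
    then show ?thesis using False that by (auto simp: V_def)
  qed
  \<comment> \<open>One map must parametrise all smaller members simultaneously, so each step has to
    extend the previous map.\<close>
  have "\<exists>f. lin (vecs R k) n f \<and> inj_on f (vecs R k) \<and> (\<forall>i. 1 \<le> i \<longrightarrow> i \<le> k \<longrightarrow> f ` vecs R i = V i)"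
    if "k \<le> n" "1 \<le> k" for k
    using that(2,1)
  proof (induction k rule: nat_induct_at_least)
    case base
    then obtain f where "lin (vecs R 1) n f" "inj_on f (vecs R 1)" "V 1 = f ` vecs R 1" using V[of 1] by blast
    moreover have "i = 1" if "1 \<le> i" "i \<le> 1" for i :: nat using that by simp
    ultimately show ?case by (intro exI[of _ f]) auto
  next
    case (Suc k)
    then obtain f where f: "lin (vecs R k) n f" "inj_on f (vecs R k)"
      and fV: "\<And>i. 1 \<le> i \<Longrightarrow> i \<le> k \<Longrightarrow> f ` vecs R i = V i" by auto
    have "k \<le> n" using Suc by simp
    have ds: "direct_summand R n (V k)" using V[OF Suc.hyps(1) \<open>k \<le> n\<close>] by blast
    have Vk: "V k = f ` vecs R k" using fV[OF Suc.hyps(1)] by simp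
    obtain q where q: "lin (vecs R n) k q" "\<And>v. v \<in> vecs R k \<Longrightarrow> q (f v) = v"
      using direct_summand_left_inverse[OF ds f Vk] by blast
    obtain h where h: "lin (vecs R (Suc k)) n h" "inj_on h (vecs R (Suc k))" "V (Suc k) = h ` vecs R (Suc k)"
      using V[of "Suc k"] Suc.prems by auto
    define h' where "h' = inv_into (vecs R (Suc k)) h"
    have h': "lin (V (Suc k)) (Suc k) h'"
      using lin_inv_into[OF h(1) submod_vecs[OF order_refl] h(2)] h(3) by (simp add: h'_def)
    have fin_V: "f ` vecs R k \<subseteq> V (Suc k)" using fV[of k] Vmono[of k] Suc by simp
    have hh': "h (h' (f v)) = f v" if "v \<in> vecs R k" for v
    proof -
      have "f v \<in> h ` vecs R (Suc k)" using fin_V h(3) that by blast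
      then show ?thesis unfolding h'_def by (rule f_inv_into_f)
    qed
    \<comment> \<open>In the coordinates \<open>h\<close> of the next member the old parametrisation
      becomes \<open>h'\<close> after \<open>f\<close>, with left inverse \<open>q\<close> after
      \<open>h\<close>.\<close>
    have hf: "lin (vecs R k) (Suc k) (\<lambda>v. h' (f v))" by (rule lin_comp[OF f(1) fin_V h'])
    have qh: "lin (vecs R (Suc k)) k (\<lambda>v. q (h v))"
      by (rule lin_comp[OF h(1) _ q(1)]) (use lin_vecs[OF h(1)] in blast)
    obtain A where A: "lin (vecs R (Suc k)) (Suc k) A" "inj_on A (vecs R (Suc k))"
      and Af: "\<And>v. v \<in> vecs R k \<Longrightarrow> A (h' (f v)) = v"
      using split_injection_completion[OF _ hf qh] hh' q(2) by auto
    note im = lin_inj_imp_image[OF A]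
    define A' where "A' = inv_into (vecs R (Suc k)) A"
    have A': "lin (vecs R (Suc k)) (Suc k) A'"
      using lin_inv_into[OF A(1) submod_vecs[OF order_refl] A(2)] by (simp add: A'_def im)
    have A'inj: "inj_on A' (vecs R (Suc k))" unfolding A'_def using im by (simp add: inj_on_inv_into)
    note im' = lin_inj_imp_image[OF A' A'inj]
    \<comment> \<open>\<open>A\<close> straightens that split injection to the standard inclusion,
      so \<open>h\<close> after the inverse of \<open>A\<close> restores \<open>f\<close> on
      R^k.\<close>
    have ext: "h (A' v) = f v" if "v \<in> vecs R k" for v
    proof -
      have "A' (A (h' (f v))) = h' (f v)"
        unfolding A'_def using A(2) lin_vecs[OF hf that] by (rule inv_into_f_f)
      then show ?thesis using Af[OF that] hh'[OF that] by simp
    qed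
    have 1: "lin (vecs R (Suc k)) n (\<lambda>v. h (A' v))" using lin_comp[OF A' _ h(1)] im' by simp
    have 2: "inj_on (\<lambda>v. h (A' v)) (vecs R (Suc k))"
      using comp_inj_on[OF A'inj, of h] im' h(2) by (simp add: o_def)
    have 3: "(\<lambda>v. h (A' v)) ` vecs R i = V i" if "1 \<le> i" "i \<le> Suc k" for i
    proof (cases "i = Suc k")
      case True
      have "(\<lambda>v. h (A' v)) ` vecs R (Suc k) = h ` (A' ` vecs R (Suc k))" by (rule image_image[symmetric])
      then show ?thesis using True im' h(3) by simp
    next
      case False
      then have "i \<le> k" using that by simp
      then have "(\<lambda>v. h (A' v)) ` vecs R i = f ` vecs R i"
        using ext vecs_mono[of i k] by (intro image_cong) auto
      then show ?thesis using fV[OF that(1) \<open>i \<le> k\<close>] by simp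
    qed
    show ?case using 1 2 3 by (intro exI[of _ "\<lambda>v. h (A' v)"]) simp
  qed
  from this[of n] obtain f where f: "lin (vecs R n) n f" "inj_on f (vecs R n)"
    and fV: "\<And>i. 1 \<le> i \<Longrightarrow> i \<le> n \<Longrightarrow> f ` vecs R i = V i" using n by auto
  obtain g where g: "g \<in> GL R n" and gf: "\<And>v. v \<in> vecs R n \<Longrightarrow> mat_vec R n g v = f v"
    using lin_inj_imp_GL[OF f] by blast
  have "G = map (\<lambda>r. mat_vec R n g ` vecs R r) [1..<n]"
  proof (rule nth_equalityI)
    fix i assume "i < length G"
    then have i: "i < n - 1" using len by simp
    have "vecs R (Suc i) \<subseteq> vecs R n" using i by (intro vecs_mono) simp
    then have "mat_vec R n g ` vecs R (Suc i) = f ` vecs R (Suc i)"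
      using gf by (intro image_cong) auto
    also have "\<dots> = V (Suc i)" using i by (intro fV) auto
    also have "\<dots> = G ! i" using i by (auto simp: V_def)
    finally show "G ! i = map (\<lambda>r. mat_vec R n g ` vecs R r) [1..<n] ! i" using i by simp
  qed (simp add: len)
  then show ?thesis using g by blast
qed

text \<open>Goodness embeds a simplex in a complete flag, which is a translate; selecting the same
  positions in \<open>[1..<n]\<close> gives the list \<open>rs\<close> of ranks. Conversely a
  translate inherits every vertex condition from the standard submodule.\<close>

theorem simplices_eq_GL_images:
  assumes n: "n \<ge> 1"
  shows "F \<in> simplices R n l \<longleftrightarrow>
    (\<exists>g\<in>GL R n. \<exists>rs. subseq rs [1..<n] \<and> length rs = l \<and> F = map (\<lambda>r. mat_vec R n g ` vecs R r) rs)"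
proof
  assume F: "F \<in> simplices R n l"
  show "\<exists>g\<in>GL R n. \<exists>rs. subseq rs [1..<n] \<and> length rs = l \<and> F = map (\<lambda>r. mat_vec R n g ` vecs R r) rs"
  proof (cases "F = []")
    case True
    then show ?thesis using F GL_one by (intro bexI[of _ "mat_one R n"] exI[of _ "[]"]) (auto simp: simplices_def)
  next
    case False
    then obtain G where G: "complete_flag R n G" "subseq F G" and l: "length F = l"
      using F by (auto simp: simplices_def good_flag_def)
    obtain g where g: "g \<in> GL R n" "G = map (\<lambda>r. mat_vec R n g ` vecs R r) [1..<n]"
      using complete_flag_eq_GL_image[OF n G(1)] by blast
    obtain N where N: "F = nths G N" using G(2) by (auto simp: subseq_conv_nths)
    have F_eq: "F = map (\<lambda>r. mat_vec R n g ` vecs R r) (nths [1..<n] N)" unfolding N g(2) by (rule nths_map)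
    moreover have "subseq (nths [1..<n] N) [1..<n]" by (auto simp: subseq_conv_nths)
    moreover have "length (nths [1..<n] N) = l" using l F_eq by (metis length_map)
    ultimately show ?thesis using g(1) by blast
  qed
next
  assume "\<exists>g\<in>GL R n. \<exists>rs. subseq rs [1..<n] \<and> length rs = l \<and> F = map (\<lambda>r. mat_vec R n g ` vecs R r) rs"
  then obtain g rs where g: "g \<in> GL R n" and rs: "subseq rs [1..<n]" "length rs = l"
    and F: "F = map (\<lambda>r. mat_vec R n g ` vecs R r) rs" by blast
  note srs = subseq_upt_sorted[OF rs(1)]
  have "complete_flag R n (map (\<lambda>r. mat_vec R n g ` vecs R r) [1..<n])"
    unfolding complete_flag_def using flag_GL_image[OF g, of "[1..<n]"] by simp
  moreover have "subseq F (map (\<lambda>r. mat_vec R n g ` vecs R r) [1..<n])"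
    unfolding F using rs(1) by (rule subseq_map)
  moreover have "flag R n F" unfolding F using flag_GL_image[OF g] srs by blast
  ultimately have "good_flag R n F" by (auto simp: good_flag_def)
  moreover have "tits_vertex R n W" if "W \<in> set F" for W
    using that srs unfolding F by (auto intro!: tits_vertex_GL_image[OF g])
  ultimately show "F \<in> simplices R n l" using rs F by (auto simp: simplices_def)
qed

end

end

section \<open>Reduction modulo an ideal in the Jacobson radical\<close>

locale radical_quotient = finite_cring +
  fixes I
  assumes ideal: "ideal I R" and radical: "I \<subseteq> jacobson_radical R"
begin

abbreviation S where "S \<equiv> R Quot I"

lemma quot_ring_hom: "ring_hom_cring R S (\<lambda>x. I +> x)"
  using ideal.rcos_ring_hom_cring[OF ideal is_cring] by simp

lemma carrier_quot: "carrier S = (\<lambda>x. I +> x) ` carrier R"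
  unfolding FactRing_def A_RCOSETS_def' by auto

sublocale Q: finite_cring S
proof (intro finite_cring.intro finite_cring_axioms.intro)
  show "cring S" by (rule ideal.quotient_is_cring[OF ideal is_cring])
  show "finite (carrier S)" unfolding carrier_quot using finite_carrier by simp
qed

lemma quot_closed: "x \<in> carrier R \<Longrightarrow> I +> x \<in> carrier S"
  by (simp add: carrier_quot)

lemma quot_zero: "I +> \<zero> = \<zero>\<^bsub>S\<^esub>"
  using ring_hom_cring.hom_zero[OF quot_ring_hom] .

lemma quot_one: "I +> \<one> = \<one>\<^bsub>S\<^esub>"
  using ring_hom_one[OF ideal.rcos_ring_hom[OF ideal]] .

lemma quot_mult: "x \<in> carrier R \<Longrightarrow> y \<in> carrier R \<Longrightarrow> I +> (x \<otimes> y) = (I +> x) \<otimes>\<^bsub>S\<^esub> (I +> y)"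
  using ring_hom_mult[OF ideal.rcos_ring_hom[OF ideal]] .

lemma quot_finsum:
  assumes "\<And>i. i \<in> A \<Longrightarrow> f i \<in> carrier R"
  shows "I +> finsum R f A = finsum S (\<lambda>i. I +> f i) A"
  using ring_hom_cring.hom_finsum[OF quot_ring_hom, of f A] assms by (simp add: o_def Pi_iff)

lemma quot_eq_iff: "x \<in> carrier R \<Longrightarrow> y \<in> carrier R \<Longrightarrow> I +> x = I +> y \<longleftrightarrow> x \<ominus> y \<in> I"
  using quotient_eq_iff_same_a_r_cos[OF ideal] by simp

lemma I_carrier: "a \<in> I \<Longrightarrow> a \<in> carrier R"
  using ideal.Icarr[OF ideal] .

text \<open>Otherwise some maximal ideal contains 1 - a. It contains \<open>a\<close> as well, by
  the radical hypothesis, and hence 1. The maximal ideal is found as a maximal member of a finite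
  family.\<close>

lemma one_minus_radical_unit:
  assumes a: "a \<in> I"
  shows "\<exists>b\<in>carrier R. (\<one> \<ominus> a) \<otimes> b = \<one>"
proof (rule ccontr)
  assume not_unit: "\<not> ?thesis"
  have ac: "a \<in> carrier R" using a by (rule I_carrier)
  then have c: "\<one> \<ominus> a \<in> carrier R" by simp
  define P where "P = {J. ideal J R \<and> PIdl (\<one> \<ominus> a) \<subseteq> J \<and> J \<noteq> carrier R}"
  have "P \<subseteq> Pow (carrier R)"
  proof
    fix J assume "J \<in> P"
    then have "ideal J R" by (simp add: P_def)
    from ideal.Icarr[OF this] show "J \<in> Pow (carrier R)" by auto
  qed
  then have "finite P" using finite_carrier finite_subset by blast
  moreover have "PIdl (\<one> \<ominus> a) \<in> P"
  proof -
    have "\<one> \<notin> PIdl (\<one> \<ominus> a)"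
      using not_unit c m_comm unfolding cgenideal_def by auto
    then show ?thesis using cgenideal_ideal[OF c] by (auto simp: P_def)
  qed
  ultimately obtain M where M: "M \<in> P" and max: "\<And>J. J \<in> P \<Longrightarrow> M \<subseteq> J \<Longrightarrow> J = M"
    using finite_has_maximal[of P] by blast
  have Mi: "ideal M R" "PIdl (\<one> \<ominus> a) \<subseteq> M" "M \<noteq> carrier R" using M by (auto simp: P_def)
  have "maximalideal M R"
  proof (rule maximalidealI[OF Mi(1) Mi(3)[symmetric]])
    fix J assume J: "ideal J R" "M \<subseteq> J"
    then have "J \<in> P" if "J \<noteq> carrier R" using that Mi(2) by (auto simp: P_def)
    then show "J = M \<or> J = carrier R" using max J(2) by blast
  qed
  then have "a \<in> M" using a radical by (auto simp: jacobson_radical_def)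
  moreover have "\<one> \<ominus> a \<in> M" using cgenideal_self[OF c] Mi(2) by blast
  ultimately have "(\<one> \<ominus> a) \<oplus> a \<in> M"
    using additive_subgroup.a_closed[OF ideal.axioms(1)[OF Mi(1)]] by blast
  moreover have "(\<one> \<ominus> a) \<oplus> a = \<one>" using ac by algebra
  ultimately show False using ideal.one_imp_carrier[OF Mi(1)] Mi(3) by simp
qed

text \<open>Gaussian elimination: 1 - N m m is a unit, so the last unknown can be solved for and
  substituted into the other equations.\<close>

lemma nakayama:
  fixes m :: nat
  assumes x: "\<And>i. x i \<in> carrier R"
  shows "(\<And>i j. N i j \<in> I) \<Longrightarrow> (\<And>i. i < m \<Longrightarrow> x i = finsum R (\<lambda>j. N i j \<otimes> x j) {..<m}) \<Longrightarrow> i < m \<Longrightarrow> x i = \<zero>"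
proof (induction m arbitrary: N i)
  case (Suc m)
  note NI = Suc.prems(1)
  have N: "N i j \<in> carrier R" for i j using NI I_carrier by blast
  obtain u where u: "u \<in> carrier R" "(\<one> \<ominus> N m m) \<otimes> u = \<one>"
    using one_minus_radical_unit[OF NI] by blast
  let ?s = "\<lambda>i. finsum R (\<lambda>j. N i j \<otimes> x j) {..<m}"
  have s: "?s i \<in> carrier R" for i using N x by (intro finsum_closed) auto
  have eq: "x i = ?s i \<oplus> N i m \<otimes> x m" if "i < Suc m" for i
    using Suc.prems(2)[OF that] N x finsum_lessThan_Suc[of m "\<lambda>j. N i j \<otimes> x j"] by simp
  have xm: "x m = u \<otimes> ?s m"
  proof -
    have "p = (p \<oplus> q) \<ominus> q" if "p \<in> carrier R" "q \<in> carrier R" for p q using that by algebra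
    from this[OF s, of "N m m \<otimes> x m" m] have "?s m = x m \<ominus> N m m \<otimes> x m" using eq[of m] N x by simp
    then have "u \<otimes> ?s m = u \<otimes> (x m \<ominus> N m m \<otimes> x m)" by simp
    also have "\<dots> = (\<one> \<ominus> N m m) \<otimes> u \<otimes> x m" using u(1) N[of m m] x[of m] by algebra
    finally show ?thesis using u(2) x by simp
  qed
  \<comment> \<open>The coefficients after substituting the expression for \<open>x m\<close>; they
    stay in \<open>I\<close> because \<open>I\<close> is an ideal.\<close>
  define N' where "N' i j = N i j \<oplus> N i m \<otimes> u \<otimes> N m j" for i j
  have N'I: "N' i j \<in> I" for i j
    unfolding N'_def using NI N u(1)
    by (intro additive_subgroup.a_closed[OF ideal.axioms(1)[OF ideal]] ideal.I_l_closed[OF ideal]) auto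
  have x0: "x i = \<zero>" if "i < m" for i
  proof (rule Suc.IH[OF N'I _ that])
    fix i assume "i < m"
    have c: "N i m \<otimes> u \<in> carrier R" using N u by simp
    have "x i = ?s i \<oplus> N i m \<otimes> u \<otimes> ?s m" using eq[of i] xm \<open>i < m\<close> N u s by (simp add: m_assoc)
    also have "N i m \<otimes> u \<otimes> ?s m = finsum R (\<lambda>j. N i m \<otimes> u \<otimes> (N m j \<otimes> x j)) {..<m}"
      using N x u by (intro finsum_rdistr) auto
    also have "?s i \<oplus> \<dots> = finsum R (\<lambda>j. N i j \<otimes> x j \<oplus> N i m \<otimes> u \<otimes> (N m j \<otimes> x j)) {..<m}"
      using N x u by (intro finsum_addf[symmetric]) auto
    also have "\<dots> = finsum R (\<lambda>j. N' i j \<otimes> x j) {..<m}"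
      using N x u by (intro finsum_cong') (auto simp: N'_def l_distr m_assoc)
    finally show "x i = finsum R (\<lambda>j. N' i j \<otimes> x j) {..<m}" .
  qed
  have "?s m = finsum R (\<lambda>j. \<zero>) {..<m}" using x0 N by (intro finsum_cong') auto
  then have "x m = \<zero>" using xm u by simp
  then show ?case using x0 Suc.prems(3) by (cases "i = m") auto
qed simp

section \<open>Lifting vectors and invertible matrices from the quotient\<close>

lemma red_vec_vecs: "v \<in> vecs R n \<Longrightarrow> red_vec R I v \<in> vecs S n"
  by (auto simp: vecs_def red_vec_def quot_closed quot_zero)

lemma red_mat_mats: "g \<in> mats R n \<Longrightarrow> red_mat R I g \<in> mats S n"
  by (auto simp: mats_def red_mat_def quot_closed quot_zero)

text \<open>Zero is lifted to zero on purpose: zero-padded vectors and matrices stay zero-padded,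
  and zero blocks stay zero.\<close>

definition lift :: "'a set \<Rightarrow> 'a" where
  "lift y = (if y = \<zero>\<^bsub>S\<^esub> then \<zero> else SOME x. x \<in> carrier R \<and> I +> x = y)"

lemma lift:
  assumes "y \<in> carrier S"
  shows "lift y \<in> carrier R" "I +> lift y = y"
proof -
  have "\<exists>x. x \<in> carrier R \<and> I +> x = y" using assms by (auto simp: carrier_quot)
  from someI_ex[OF this] show "lift y \<in> carrier R" "I +> lift y = y"
    by (auto simp: lift_def quot_zero)
qed

lemma lift_zero: "lift \<zero>\<^bsub>S\<^esub> = \<zero>"
  by (simp add: lift_def)

lemma red_vec_image: "red_vec R I ` vecs R r = vecs S r"
proof
  show "red_vec R I ` vecs R r \<subseteq> vecs S r" using red_vec_vecs by blast
  show "vecs S r \<subseteq> red_vec R I ` vecs R r"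
  proof
    fix y assume y: "y \<in> vecs S r"
    then have "(\<lambda>i. lift (y i)) \<in> vecs R r" by (auto simp: vecs_def lift lift_zero)
    moreover have "red_vec R I (\<lambda>i. lift (y i)) = y"
      using Q.vecs_closed[OF y] by (auto simp: red_vec_def lift)
    ultimately show "y \<in> red_vec R I ` vecs R r" by (metis imageI)
  qed
qed

lemma lift_mat:
  assumes "g \<in> mats S n"
  shows "(\<lambda>i j. lift (g i j)) \<in> mats R n" "red_mat R I (\<lambda>i j. lift (g i j)) = g"
proof -
  have "g i j \<in> carrier S" for i j using Q.vecs_closed[OF Q.mats_column[OF assms]] .
  then show "(\<lambda>i j. lift (g i j)) \<in> mats R n" "red_mat R I (\<lambda>i j. lift (g i j)) = g"
    using assms by (auto simp: mats_def red_mat_def lift lift_zero)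
qed

lemma red_mat_vec:
  assumes g: "g \<in> mats R n" and v: "v \<in> vecs R n"
  shows "red_vec R I (mat_vec R n g v) = mat_vec S n (red_mat R I g) (red_vec R I v)"
proof
  fix i
  have c: "v j \<in> carrier R" "g i j \<in> carrier R" for j
    using vecs_closed[OF v] vecs_closed[OF mats_column[OF g]] by auto
  show "red_vec R I (mat_vec R n g v) i = mat_vec S n (red_mat R I g) (red_vec R I v) i"
    using c by (simp add: red_vec_def red_mat_def mat_vec_def quot_zero quot_finsum quot_mult)
qed

lemma red_mat_mul:
  assumes g: "g \<in> mats R n" and h: "h \<in> mats R n"
  shows "red_mat R I (mat_mul R n g h) = mat_mul S n (red_mat R I g) (red_mat R I h)"
proof (intro ext)
  fix i j
  have c: "g i k \<in> carrier R" "h k j \<in> carrier R" for k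
    using vecs_closed[OF mats_column[OF g]] vecs_closed[OF mats_column[OF h]] by auto
  show "red_mat R I (mat_mul R n g h) i j = mat_mul S n (red_mat R I g) (red_mat R I h) i j"
    using c by (simp add: red_mat_def mat_mul_def quot_zero quot_finsum quot_mult)
qed

lemma red_mat_one: "red_mat R I (mat_one R n) = mat_one S n"
  by (simp add: red_mat_def mat_one_def fun_eq_iff quot_zero quot_one)

lemma red_mat_GL:
  assumes "g \<in> GL R n"
  shows "red_mat R I g \<in> GL S n"
proof -
  obtain h where h: "h \<in> GL R n" "mat_mul R n g h = mat_one R n" "mat_mul R n h g = mat_one R n"
    using GL_inverse[OF assms] by blast
  have "mat_mul S n (red_mat R I g) (red_mat R I h) = mat_one S n"
    "mat_mul S n (red_mat R I h) (red_mat R I g) = mat_one S n"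
    using h assms by (simp_all add: red_mat_mul[symmetric] GL_mats red_mat_one)
  then show ?thesis using h assms by (auto simp: GL_def[of S] GL_mats red_mat_mats)
qed

text \<open>A kernel vector \<open>v\<close> of \<open>k\<close> satisfies v = N v, where N = 1 - k
  has entries in \<open>I\<close>, so it vanishes by \<open>nakayama\<close>.\<close>

lemma GL_if_red_mat_one:
  assumes k: "k \<in> mats R n" and one: "red_mat R I k = mat_one S n"
  shows "k \<in> GL R n"
proof -
  have kc: "k i j \<in> carrier R" for i j using vecs_closed[OF mats_column[OF k]] .
  have oc: "mat_one R n i j \<in> carrier R" for i j by (simp add: mat_one_def)
  define N where "N i j = mat_one R n i j \<ominus> k i j" for i j
  have NI: "N i j \<in> I" for i j
    using fun_cong[OF fun_cong[OF one], of i j] quot_eq_iff[OF oc kc, of i j i j]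
      fun_cong[OF fun_cong[OF red_mat_one], of n i j]
    by (simp add: N_def red_mat_def)
  have "inj_on (mat_vec R n k) (vecs R n)"
  proof (rule lin_inj_onI[OF lin_mat_vec[OF k] submod_vecs[OF order_refl]])
    fix v assume v: "v \<in> vecs R n" and z: "mat_vec R n k v = vzero R"
    note vc = vecs_closed[OF v]
    have Nc: "N i j \<in> carrier R" for i j using NI I_carrier by blast
    have sc: "finsum R (\<lambda>j. N i j \<otimes> v j) {..<n} \<in> carrier R" for i
      using Nc vc by (intro finsum_closed) auto
    have "v i = finsum R (\<lambda>j. N i j \<otimes> v j) {..<n}" if i: "i < n" for i
    proof -
      have "v i = finsum R (\<lambda>j. mat_one R n i j \<otimes> v j) {..<n}"
        using fun_cong[OF mat_vec_mat_one[OF v], of i] i by (simp add: mat_vec_def)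
      also have "\<dots> = finsum R (\<lambda>j. N i j \<otimes> v j \<oplus> k i j \<otimes> v j) {..<n}"
      proof (rule finsum_cong'[OF refl])
        fix j
        show "mat_one R n i j \<otimes> v j = N i j \<otimes> v j \<oplus> k i j \<otimes> v j"
          unfolding N_def using oc[of i j] kc[of i j] vc[of j] by algebra
      qed (use Nc kc vc in auto)
      also have "\<dots> = finsum R (\<lambda>j. N i j \<otimes> v j) {..<n} \<oplus> finsum R (\<lambda>j. k i j \<otimes> v j) {..<n}"
        using Nc kc vc by (intro finsum_addf) auto
      also have "finsum R (\<lambda>j. k i j \<otimes> v j) {..<n} = \<zero>"
        using fun_cong[OF z, of i] i by (simp add: mat_vec_def vzero_def)
      finally show ?thesis using sc by simp
    qed
    from nakayama[OF vc NI this] have "v i = \<zero>" if "i < n" for i using that by blast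
    then have "v i = \<zero>" for i using v by (cases "i < n") (auto simp: vecs_def)
    then show "v = vzero R" by (simp add: vzero_def fun_eq_iff)
  qed
  then show ?thesis using k by (simp add: GL_iff)
qed

text \<open>Multiplying by a lift of the inverse gives a matrix that reduces to the identity, hence
  an injective one; injectivity of the product passes to its right factor \<open>g\<close>.\<close>

lemma GL_if_red_mat_GL:
  assumes g: "g \<in> mats R n" and red: "red_mat R I g \<in> GL S n"
  shows "g \<in> GL R n"
proof -
  obtain h' where h': "h' \<in> GL S n" "mat_mul S n h' (red_mat R I g) = mat_one S n"
    using Q.GL_inverse[OF red] by blast
  define h where "h = (\<lambda>i j. lift (h' i j))"
  have h: "h \<in> mats R n" "red_mat R I h = h'" using lift_mat[OF Q.GL_mats[OF h'(1)]] by (auto simp: h_def)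
  have "mat_mul R n h g \<in> GL R n"
    by (rule GL_if_red_mat_one) (simp_all add: mat_mul_mats red_mat_mul g h h')
  then have "inj_on (mat_vec R n (mat_mul R n h g)) (vecs R n)" by (simp add: GL_iff)
  then have "inj_on (mat_vec R n h \<circ> mat_vec R n g) (vecs R n)"
    using g h by (simp add: mat_vec_mat_mul o_def cong: inj_on_cong)
  then have "inj_on (mat_vec R n g) (vecs R n)" by (rule inj_on_imageI2)
  then show ?thesis using g by (simp add: GL_iff)
qed

text \<open>Outside the block of indices below \<open>n\<close> both matrices are zero, so entrywise
  congruence inside it amounts to equality of the reductions as functions.\<close>

lemma congruence_subgroup_iff:
  "g \<in> congruence_subgroup R I n \<longleftrightarrow> g \<in> GL R n \<and> red_mat R I g = mat_one S n"
proof (cases "g \<in> GL R n")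
  case True
  note gm = GL_mats[OF True]
  have gc: "g i j \<in> carrier R" for i j using vecs_closed[OF mats_column[OF gm]] .
  have oc: "mat_one R n i j \<in> carrier R" for i j by (simp add: mat_one_def)
  have "red_mat R I g = mat_one S n \<longleftrightarrow> (\<forall>i j. red_mat R I g i j = red_mat R I (mat_one R n) i j)"
    by (simp add: fun_eq_iff red_mat_one)
  also have "\<dots> \<longleftrightarrow> (\<forall>i<n. \<forall>j<n. red_mat R I g i j = red_mat R I (mat_one R n) i j)"
  proof -
    have "red_mat R I g i j = red_mat R I (mat_one R n) i j" if "\<not> (i < n \<and> j < n)" for i j
    proof -
      have "g i j = \<zero>" "mat_one R n i j = \<zero>" using gm mat_one_mats[of n] that unfolding mats_def by blast+
      then show ?thesis by (simp add: red_mat_def)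
    qed
    then show ?thesis by blast
  qed
  also have "\<dots> \<longleftrightarrow> (\<forall>i<n. \<forall>j<n. g i j \<ominus> mat_one R n i j \<in> I)"
    by (simp add: red_mat_def quot_eq_iff gc oc)
  finally show ?thesis using True by (simp add: congruence_subgroup_def)
qed (simp add: congruence_subgroup_def)

end

section \<open>The Tits complex under reduction\<close>

lemma map_del_at: "map f (del_at i F) = del_at i (map f F)"
  by (simp add: del_at_def take_map drop_map)

text \<open>A face is a subsequence of its simplex and so lies in the same complete flag.\<close>

lemma del_at_simplices:
  assumes "i < l" and F: "F \<in> simplices R n l"
  shows "del_at i F \<in> simplices R n (l - 1)"
proof -
  have len: "length F = l" and "F \<noteq> []" using assms by (auto simp: simplices_def)
  then obtain G where G: "complete_flag R n G" "subseq F G" and fl: "flag R n F"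
    and vt: "\<And>V. V \<in> set F \<Longrightarrow> tits_vertex R n V"
    using F by (auto simp: simplices_def good_flag_def)
  have split: "F = take i F @ F ! i # drop (Suc i) F" using assms(1) len by (intro id_take_nth_drop) simp
  have sub: "subseq (del_at i F) F"
    unfolding del_at_def by (subst (3) split) (simp add: subseq_append' list_emb_Cons)
  then have set: "set (del_at i F) \<subseteq> set F" by (auto simp: subseq_conv_nths dest: in_set_nthsD)
  have "sorted_wrt (\<subset>) (take i F @ F ! i # drop (Suc i) F)" using fl split unfolding flag_def by simp
  then have "sorted_wrt (\<subset>) (del_at i F)" by (simp add: del_at_def sorted_wrt_append)
  then have "flag R n (del_at i F)" using fl set by (auto simp: flag_def)
  moreover have "subseq (del_at i F) G" using sub G(2) by (rule subseq_order.trans)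
  ultimately have "good_flag R n (del_at i F)" using G(1) by (auto simp: good_flag_def)
  moreover have "length (del_at i F) = l - 1" using assms(1) len by (simp add: del_at_def)
  ultimately show ?thesis using vt set by (auto simp: simplices_def)
qed

context finite_cring
begin

lemma simplices_subset_vecs:
  assumes "F \<in> simplices R n l" "V \<in> set F"
  shows "V \<subseteq> vecs R n"
proof -
  have "tits_vertex R n V" using assms unfolding simplices_def by auto
  then show ?thesis unfolding tits_vertex_def direct_summand_def submod_def by (elim conjE)
qed

lemma finite_simplices: "finite (simplices R n l)"
proof (rule finite_subset)
  show "simplices R n l \<subseteq> {F. set F \<subseteq> Pow (vecs R n) \<and> length F = l}"
    using simplices_subset_vecs by (auto simp: simplices_def)
  show "finite {F. set F \<subseteq> Pow (vecs R n) \<and> length F = l}"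
    by (rule finite_lists_length_eq) (simp add: finite_vecs)
qed

text \<open>Over the zero ring every submodule is zero, so there are no vertices and only the empty
  simplex remains.\<close>

lemma simplices_trivial:
  assumes "\<one> = \<zero>"
  shows "simplices R n l = (if l = 0 then {[]} else {})"
proof -
  have x0: "x = \<zero>" if "x \<in> carrier R" for x
    using l_one[OF that] l_null[OF that] assms by simp
  have "vecs R n \<subseteq> {vzero R}"
  proof
    fix v assume "v \<in> vecs R n"
    from x0[OF vecs_closed[OF this]] show "v \<in> {vzero R}" by (simp add: vzero_def fun_eq_iff)
  qed
  moreover have "V = {vzero R}" if "submod R n V" "V \<subseteq> {vzero R}" for V
    using submod_zero[OF that(1)] that(2) by blast
  ultimately have "\<not> tits_vertex R n V" for V
    using submod_subset unfolding tits_vertex_def direct_summand_def by (metis subset_trans)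
  then show ?thesis by (auto simp: simplices_def)
qed

lemma act_flag_mult:
  assumes "g \<in> mats R n" "h \<in> mats R n" "\<And>V. V \<in> set F \<Longrightarrow> V \<subseteq> vecs R n"
  shows "act_flag R n g (act_flag R n h F) = act_flag R n (mat_mul R n g h) F"
proof -
  have "mat_vec R n g ` (mat_vec R n h ` V) = mat_vec R n (mat_mul R n g h) ` V" if "V \<in> set F" for V
    unfolding image_image using assms(3)[OF that] by (intro image_cong) (auto simp: mat_vec_mat_mul assms)
  then show ?thesis by (simp add: act_flag_def)
qed

lemma act_flag_one:
  assumes "\<And>V. V \<in> set F \<Longrightarrow> V \<subseteq> vecs R n"
  shows "act_flag R n (mat_one R n) F = F"
proof -
  have "mat_vec R n (mat_one R n) ` V = V" if "V \<in> set F" for V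
    using assms[OF that] by (force simp: mat_vec_mat_one subset_iff image_iff)
  then show ?thesis by (simp add: act_flag_def map_idI)
qed

lemma act_flag_GL_image:
  assumes "g \<in> mats R n" "h \<in> mats R n" "set rs \<subseteq> {1..<n}"
  shows "act_flag R n g (map (\<lambda>r. mat_vec R n h ` vecs R r) rs)
    = map (\<lambda>r. mat_vec R n (mat_mul R n g h) ` vecs R r) rs"
proof -
  have "mat_vec R n g ` (mat_vec R n h ` vecs R r) = mat_vec R n (mat_mul R n g h) ` vecs R r" if "r \<in> set rs" for r
  proof -
    have "vecs R r \<subseteq> vecs R n" using assms(3) that by (intro vecs_mono) auto
    then show ?thesis unfolding image_image by (intro image_cong) (auto simp: mat_vec_mat_mul assms)
  qed
  then show ?thesis by (simp add: act_flag_def)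
qed

lemma act_flag_simplices:
  assumes n: "n \<ge> 1" and g: "g \<in> GL R n" and F: "F \<in> simplices R n l"
  shows "act_flag R n g F \<in> simplices R n l"
proof (cases "\<one> = \<zero>")
  case True
  then show ?thesis using F by (simp add: simplices_trivial act_flag_def split: if_splits)
next
  case False
  obtain h rs where h: "h \<in> GL R n" and rs: "subseq rs [1..<n]" "length rs = l"
    "F = map (\<lambda>r. mat_vec R n h ` vecs R r) rs"
    using F simplices_eq_GL_images[OF False n] by blast
  have "act_flag R n g F = map (\<lambda>r. mat_vec R n (mat_mul R n g h) ` vecs R r) rs"
    unfolding rs(3) using subseq_upt_sorted[OF rs(1)] g h by (intro act_flag_GL_image) (auto simp: GL_mats)
  then show ?thesis
    using simplices_eq_GL_images[OF False n] GL_mult[OF g h] rs(1,2) by blast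
qed

lemma bij_betw_act_flag:
  assumes n: "n \<ge> 1" and g: "g \<in> GL R n"
  shows "bij_betw (act_flag R n g) (simplices R n l) (simplices R n l)"
proof -
  obtain h where h: "h \<in> GL R n" "mat_mul R n g h = mat_one R n" "mat_mul R n h g = mat_one R n"
    using GL_inverse[OF g] by blast
  show ?thesis
  proof (rule bij_betwI[where g="act_flag R n h"])
    fix F assume F: "F \<in> simplices R n l"
    note V = simplices_subset_vecs[OF F]
    show "act_flag R n h (act_flag R n g F) = F" "act_flag R n g (act_flag R n h F) = F"
      using g h V by (simp_all add: act_flag_mult GL_mats act_flag_one)
  qed (use act_flag_simplices[OF n] g h in auto)
qed

end

section \<open>Surjectivity and fibres of reduction on flags\<close>

context radical_quotient
begin

text \<open>If 1 lay in \<open>I\<close>, then 1 - 1 = 0 would be a unit. Hence a case distinction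
  on \<open>R\<close> settles the quotient at the same time.\<close>

lemma quot_one_eq_zero_iff: "\<one>\<^bsub>S\<^esub> = \<zero>\<^bsub>S\<^esub> \<longleftrightarrow> \<one> = \<zero>"
proof
  assume "\<one>\<^bsub>S\<^esub> = \<zero>\<^bsub>S\<^esub>"
  then have "I +> \<one> = I +> \<zero>" by (simp add: quot_one quot_zero)
  then have "\<one> \<in> I" using quot_eq_iff[of \<one> \<zero>] by (simp add: minus_eq)
  then obtain b where "b \<in> carrier R" "(\<one> \<ominus> \<one>) \<otimes> b = \<one>" using one_minus_radical_unit by blast
  then show "\<one> = \<zero>" by (simp add: minus_eq r_neg)
qed (metis quot_one quot_zero)

lemma red_flag_act_flag:
  assumes "g \<in> mats R n" "\<And>V. V \<in> set F \<Longrightarrow> V \<subseteq> vecs R n"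
  shows "red_flag R I (act_flag R n g F) = act_flag S n (red_mat R I g) (red_flag R I F)"
proof -
  have "red_vec R I ` (mat_vec R n g ` V) = mat_vec S n (red_mat R I g) ` (red_vec R I ` V)" if "V \<in> set F" for V
    unfolding image_image using assms(2)[OF that] by (intro image_cong) (auto simp: red_mat_vec assms(1))
  then show ?thesis by (simp add: red_flag_def act_flag_def)
qed

lemma red_flag_GL_image:
  assumes "g \<in> mats R n" "set rs \<subseteq> {1..<n}"
  shows "red_flag R I (map (\<lambda>r. mat_vec R n g ` vecs R r) rs)
    = map (\<lambda>r. mat_vec S n (red_mat R I g) ` vecs S r) rs"
proof -
  have "red_vec R I ` (mat_vec R n g ` vecs R r) = mat_vec S n (red_mat R I g) ` vecs S r" if "r \<in> set rs" for r
  proof -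
    have "vecs R r \<subseteq> vecs R n" using assms(2) that by (intro vecs_mono) auto
    then have "red_vec R I ` (mat_vec R n g ` vecs R r) = mat_vec S n (red_mat R I g) ` (red_vec R I ` vecs R r)"
      unfolding image_image by (intro image_cong) (auto simp: red_mat_vec assms(1))
    then show ?thesis by (simp add: red_vec_image)
  qed
  then show ?thesis by (simp add: red_flag_def)
qed

text \<open>On a translate, reduction changes the matrix and keeps the ranks \<open>rs\<close>;
  surjectivity holds since any invertible matrix over the quotient has an invertible lift.\<close>

lemma red_flag_image:
  assumes n: "n \<ge> 1"
  shows "red_flag R I ` simplices R n l = simplices S n l"
proof (cases "\<one> = \<zero>")
  case True
  then show ?thesis
    using simplices_trivial[OF True, of n l] Q.simplices_trivial[of n l] quot_one_eq_zero_iff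
    by (simp add: red_flag_def)
next
  case False
  then have F': "\<one>\<^bsub>S\<^esub> \<noteq> \<zero>\<^bsub>S\<^esub>" by (simp add: quot_one_eq_zero_iff)
  show ?thesis
  proof
    show "red_flag R I ` simplices R n l \<subseteq> simplices S n l"
    proof
      fix F' assume "F' \<in> red_flag R I ` simplices R n l"
      then obtain F where F: "F \<in> simplices R n l" "F' = red_flag R I F" by blast
      then obtain g rs where g: "g \<in> GL R n" and rs: "subseq rs [1..<n]" "length rs = l"
        "F = map (\<lambda>r. mat_vec R n g ` vecs R r) rs"
        using simplices_eq_GL_images[OF False n] by blast
      have "F' = map (\<lambda>r. mat_vec S n (red_mat R I g) ` vecs S r) rs"
        unfolding F(2) rs(3) using subseq_upt_sorted[OF rs(1)] g by (intro red_flag_GL_image) (auto simp: GL_mats)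
      then show "F' \<in> simplices S n l"
        using Q.simplices_eq_GL_images[OF F' n] red_mat_GL[OF g] rs(1,2) by blast
    qed
    show "simplices S n l \<subseteq> red_flag R I ` simplices R n l"
    proof
      fix F' assume "F' \<in> simplices S n l"
      then obtain g' rs where g': "g' \<in> GL S n" and rs: "subseq rs [1..<n]" "length rs = l"
        "F' = map (\<lambda>r. mat_vec S n g' ` vecs S r) rs"
        using Q.simplices_eq_GL_images[OF F' n] by blast
      define g where "g = (\<lambda>i j. lift (g' i j))"
      have gm: "g \<in> mats R n" "red_mat R I g = g'" using lift_mat[OF Q.GL_mats[OF g']] by (auto simp: g_def)
      then have "g \<in> GL R n" using GL_if_red_mat_GL g' by simp
      then have "map (\<lambda>r. mat_vec R n g ` vecs R r) rs \<in> simplices R n l"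
        using simplices_eq_GL_images[OF False n] rs(1,2) by blast
      moreover have "F' = red_flag R I (map (\<lambda>r. mat_vec R n g ` vecs R r) rs)"
        unfolding rs(3) using red_flag_GL_image[OF gm(1), of rs] subseq_upt_sorted[OF rs(1)] gm(2) by simp
      ultimately show "F' \<in> red_flag R I ` simplices R n l" by blast
    qed
  qed
qed

text \<open>A matrix stabilising \<open>S^r\<close> has zero entries below the corresponding block; lifting them to
  zero keeps \<open>R^r\<close> stable.\<close>

lemma lift_stabiliser:
  assumes p: "p \<in> GL S n" and r: "r \<le> n" and stab: "mat_vec S n p ` vecs S r \<subseteq> vecs S r"
  shows "mat_vec R n (\<lambda>i j. lift (p i j)) ` vecs R r = vecs R r"
proof -
  let ?q = "\<lambda>i j. lift (p i j)"
  have qm: "?q \<in> mats R n" using lift_mat[OF Q.GL_mats[OF p]] by blast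
  have q: "?q \<in> GL R n" using GL_if_red_mat_GL[OF qm] lift_mat[OF Q.GL_mats[OF p]] p by simp
  have z: "?q i j = \<zero>" if "r \<le> i" "j < r" for i j
  proof -
    have "mat_vec S n p (Q.unit_vec j) \<in> vecs S r" using stab Q.unit_vec_vecs[OF that(2)] by blast
    then have "(\<lambda>i. p i j) \<in> vecs S r" using Q.mat_vec_unit_vec[OF Q.GL_mats[OF p], of j] that r by simp
    then show ?thesis using that by (simp add: vecs_def lift_zero)
  qed
  have "mat_vec R n ?q ` vecs R r \<subseteq> vecs R r"
  proof
    fix y assume "y \<in> mat_vec R n ?q ` vecs R r"
    then obtain x where x: "x \<in> vecs R r" "y = mat_vec R n ?q x" by blast
    have xn: "x \<in> vecs R n" using x vecs_mono[OF r] by blast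
    have qc: "?q i j \<in> carrier R" for i j using vecs_closed[OF mats_column[OF qm]] .
    have y0: "y i = \<zero>" if "r \<le> i" for i
    proof -
      have "x j \<otimes> ?q i j = \<zero>" for j
        using z[OF that, of j] x(1) qc[of i j] vecs_closed[OF x(1), of j] by (cases "j < r") (auto simp: vecs_def)
      then have "finsum R (\<lambda>j. x j \<otimes> ?q i j) {..<n} = \<zero>" by simp
      then show ?thesis using x(2) mat_vec_columns[OF qm xn] by simp
    qed
    have "y \<in> vecs R n" unfolding x(2) by (rule mat_vec_vecs[OF qm xn])
    from vecs_closed[OF this] y0 show "y \<in> vecs R r" by (simp add: vecs_def)
  qed
  \<comment> \<open>An injective self-map of a finite set is onto, so stability becomes
    equality.\<close>
  then show ?thesis using GL_inj_on_vecs[OF q r] finite_vecs by (intro endo_inj_surj)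
qed

text \<open>For the direction from equal reductions, \<open>g\<close> is first replaced by another
  matrix of the same flag \<open>F\<close> that agrees with \<open>g'\<close> modulo
  \<open>I\<close>; the quotient of the two then lies in the congruence subgroup.\<close>

lemma red_flag_eq_iff:
  assumes n: "n \<ge> 1" and F: "F \<in> simplices R n l" and F': "F' \<in> simplices R n l"
  shows "red_flag R I F' = red_flag R I F \<longleftrightarrow> (\<exists>c\<in>congruence_subgroup R I n. F' = act_flag R n c F)"
proof
  assume "\<exists>c\<in>congruence_subgroup R I n. F' = act_flag R n c F"
  then obtain c where c: "c \<in> GL R n" "red_mat R I c = mat_one S n" "F' = act_flag R n c F"
    using congruence_subgroup_iff by blast
  have "red_flag R I F \<in> simplices S n l" using red_flag_image[OF n] F by blast
  note V = Q.simplices_subset_vecs[OF this]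
  show "red_flag R I F' = red_flag R I F"
    using red_flag_act_flag[OF GL_mats[OF c(1)] simplices_subset_vecs[OF F]] c Q.act_flag_one[OF V] by simp
next
  assume eq: "red_flag R I F' = red_flag R I F"
  show "\<exists>c\<in>congruence_subgroup R I n. F' = act_flag R n c F"
  proof (cases "\<one> = \<zero>")
    case True
    then have "F = []" "F' = []" using F F' by (auto simp: simplices_trivial split: if_splits)
    then show ?thesis
      using congruence_subgroup_iff[of "mat_one R n" n] GL_one red_mat_one
      by (intro bexI[of _ "mat_one R n"]) (auto simp: act_flag_def)
  next
    case False
    then have nt: "\<one>\<^bsub>S\<^esub> \<noteq> \<zero>\<^bsub>S\<^esub>" by (simp add: quot_one_eq_zero_iff)
    obtain g rs where g: "g \<in> GL R n" and rs: "subseq rs [1..<n]" "length rs = l"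
      and Fe: "F = map (\<lambda>r. mat_vec R n g ` vecs R r) rs"
      using F simplices_eq_GL_images[OF False n] by blast
    obtain g' rs' where g': "g' \<in> GL R n" and rs': "subseq rs' [1..<n]" "length rs' = l"
      and Fe': "F' = map (\<lambda>r. mat_vec R n g' ` vecs R r) rs'"
      using F' simplices_eq_GL_images[OF False n] by blast
    have sr: "set rs \<subseteq> {1..<n}" and sr': "set rs' \<subseteq> {1..<n}" using rs rs' subseq_upt_sorted by blast+
    have bar: "red_mat R I g \<in> GL S n" "red_mat R I g' \<in> GL S n" using g g' red_mat_GL by auto
    have meq: "map (\<lambda>r. mat_vec S n (red_mat R I g') ` vecs S r) rs'
        = map (\<lambda>r. mat_vec S n (red_mat R I g) ` vecs S r) rs"
      using eq red_flag_GL_image[OF GL_mats[OF g] sr] red_flag_GL_image[OF GL_mats[OF g'] sr'] Fe Fe' by simp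
    \<comment> \<open>Equal images have equal cardinalities, and over the nontrivial quotient ring
      these determine the ranks.\<close>
    have rs_eq: "rs' = rs"
    proof (rule nth_equalityI)
      show "length rs' = length rs" using rs rs' by simp
      fix i assume i: "i < length rs'"
      have "rs ! i \<in> set rs" "rs' ! i \<in> set rs'" using i rs rs' by simp_all
      then have le: "rs ! i \<le> n" "rs' ! i \<le> n" using sr sr' by auto
      have "mat_vec S n (red_mat R I g') ` vecs S (rs' ! i) = mat_vec S n (red_mat R I g) ` vecs S (rs ! i)"
        using arg_cong[OF meq, of "\<lambda>xs. xs ! i"] i rs rs' by simp
      then have "card (carrier S) ^ (rs' ! i) = card (carrier S) ^ (rs ! i)"
        using Q.card_GL_image[OF bar(2) le(2)] Q.card_GL_image[OF bar(1) le(1)] by simp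
      then show "rs' ! i = rs ! i"
        using Q.card_power_less_iff[OF nt] by (metis less_irrefl linorder_neqE_nat)
    qed
    obtain h where h: "h \<in> GL S n"
      and hg: "\<And>v. v \<in> vecs S n \<Longrightarrow> mat_vec S n h (mat_vec S n (red_mat R I g) v) = v"
      and gh: "mat_mul S n (red_mat R I g) h = mat_one S n"
      using Q.GL_inverse[OF bar(1)] by blast
    \<comment> \<open>The discrepancy of the two reduced matrices. It stabilises S^r for each
      \<open>r\<close> in \<open>rs\<close>, since both matrices send S^r to the same member of the
      reduced flag.\<close>
    define p where "p = mat_mul S n h (red_mat R I g')"
    have p: "p \<in> GL S n" unfolding p_def by (rule Q.GL_mult[OF h bar(2)])
    have gp: "mat_mul S n (red_mat R I g) p = red_mat R I g'"
      unfolding p_def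
    proof (rule Q.mats_eqI)
      fix v assume v: "v \<in> vecs S n"
      let ?w = "mat_vec S n (red_mat R I g') v"
      have w: "?w \<in> vecs S n" using Q.mat_vec_vecs[OF Q.GL_mats[OF bar(2)] v] .
      have "mat_vec S n (red_mat R I g) (mat_vec S n h ?w) = ?w"
        using Q.mat_vec_mat_mul[OF Q.GL_mats[OF bar(1)] Q.GL_mats[OF h] w] gh Q.mat_vec_mat_one[OF w] by simp
      then show "mat_vec S n (mat_mul S n (red_mat R I g) (mat_mul S n h (red_mat R I g'))) v = ?w"
        using v h bar by (simp add: Q.mat_vec_mat_mul Q.mat_mul_mats Q.GL_mats)
    qed (use h bar in \<open>simp_all add: Q.mat_mul_mats Q.GL_mats\<close>)
    have stab: "mat_vec S n p ` vecs S r \<subseteq> vecs S r" if r: "r \<in> set rs" for r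
    proof -
      have sub: "vecs S r \<subseteq> vecs S n" using r sr by (intro Q.vecs_mono) auto
      obtain i where "i < length rs" "r = rs ! i" using r by (auto simp: in_set_conv_nth)
      then have im: "mat_vec S n (red_mat R I g') ` vecs S r = mat_vec S n (red_mat R I g) ` vecs S r"
        using arg_cong[OF meq, of "\<lambda>xs. xs ! i"] rs_eq by simp
      have "mat_vec S n p ` vecs S r = mat_vec S n h ` (mat_vec S n (red_mat R I g') ` vecs S r)"
        unfolding image_image p_def using sub h bar
        by (intro image_cong) (auto simp: Q.mat_vec_mat_mul Q.GL_mats)
      also have "\<dots> = (\<lambda>v. mat_vec S n h (mat_vec S n (red_mat R I g) v)) ` vecs S r"
        unfolding im image_image ..
      also have "\<dots> = (\<lambda>v. v) ` vecs S r" using sub hg by (intro image_cong) auto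
      finally show ?thesis by simp
    qed
    define q where "q = (\<lambda>i j. lift (p i j))"
    have qm: "q \<in> mats R n" "red_mat R I q = p" using lift_mat[OF Q.GL_mats[OF p]] by (auto simp: q_def)
    have q: "q \<in> GL R n" using GL_if_red_mat_GL[OF qm(1)] qm(2) p by simp
    have qr: "mat_vec R n q ` vecs R r = vecs R r" if "r \<in> set rs" for r
      unfolding q_def using that sr stab by (intro lift_stabiliser[OF p]) auto
    \<comment> \<open>\<open>k\<close> represents the same flag \<open>F\<close> as
      \<open>g\<close>, because \<open>q\<close> stabilises each R^r involved, but it reduces to the
      same matrix as \<open>g'\<close>.\<close>
    define k where "k = mat_mul R n g q"
    have k: "k \<in> GL R n" unfolding k_def by (rule GL_mult[OF g q])
    have redk: "red_mat R I k = red_mat R I g'"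
      unfolding k_def using red_mat_mul[OF GL_mats[OF g] qm(1)] qm(2) gp by simp
    obtain k' where k': "k' \<in> GL R n" and kk: "mat_mul R n k k' = mat_one R n"
      and k'k: "\<And>v. v \<in> vecs R n \<Longrightarrow> mat_vec R n k' (mat_vec R n k v) = v"
      using GL_inverse[OF k] by blast
    \<comment> \<open>\<open>g'\<close> times the inverse of \<open>k\<close>: it reduces to the
      identity and carries \<open>k\<close> to \<open>g'\<close>, hence \<open>F\<close> to
      \<open>F'\<close>.\<close>
    define c where "c = mat_mul R n g' k'"
    have c: "c \<in> GL R n" unfolding c_def by (rule GL_mult[OF g' k'])
    have "red_mat R I c = mat_mul S n (red_mat R I k) (red_mat R I k')"
      unfolding c_def redk by (rule red_mat_mul[OF GL_mats[OF g'] GL_mats[OF k']])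
    also have "\<dots> = mat_one S n"
      using red_mat_mul[OF GL_mats[OF k] GL_mats[OF k']] kk red_mat_one by simp
    finally have "c \<in> congruence_subgroup R I n" using c congruence_subgroup_iff by blast
    moreover have "F' = act_flag R n c F"
    proof -
      have Fk: "F = map (\<lambda>r. mat_vec R n k ` vecs R r) rs"
      proof -
        have "mat_vec R n k ` vecs R r = mat_vec R n g ` vecs R r" if r: "r \<in> set rs" for r
        proof -
          have sub: "vecs R r \<subseteq> vecs R n" using r sr by (intro vecs_mono) auto
          have "mat_vec R n k ` vecs R r = mat_vec R n g ` (mat_vec R n q ` vecs R r)"
            unfolding image_image k_def using sub g qm(1)
            by (intro image_cong) (auto simp: mat_vec_mat_mul GL_mats)
          then show ?thesis using qr[OF r] by simp
        qed
        then show ?thesis unfolding Fe by simp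
      qed
      have ck: "mat_mul R n c k = g'"
      proof (rule mats_eqI)
        fix v assume v: "v \<in> vecs R n"
        have kv: "mat_vec R n k v \<in> vecs R n" using mat_vec_vecs[OF GL_mats[OF k] v] .
        have "mat_vec R n (mat_mul R n c k) v = mat_vec R n g' (mat_vec R n k' (mat_vec R n k v))"
          using mat_vec_mat_mul[OF GL_mats[OF c] GL_mats[OF k] v]
            mat_vec_mat_mul[OF GL_mats[OF g'] GL_mats[OF k'] kv] by (simp add: c_def)
        then show "mat_vec R n (mat_mul R n c k) v = mat_vec R n g' v" using k'k[OF v] by simp
      qed (use c k g' in \<open>simp_all add: mat_mul_mats GL_mats\<close>)
      show ?thesis
        unfolding Fk act_flag_GL_image[OF GL_mats[OF c] GL_mats[OF k] sr] ck Fe' rs_eq ..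
    qed
    ultimately show ?thesis by blast
  qed
qed

end

lemma st_map_eq_push: "st_map R I n = push (simplices R n (n - 1)) (red_flag R I) (simplices (R Quot I) n (n - 1))"
  by (simp add: st_map_def push_def fun_eq_iff)

lemma act_st_eq_push: "act_st R n g = push (simplices R n (n - 1)) (act_flag R n g) (simplices R n (n - 1))"
  by (simp add: act_st_def act_chain_def push_def fun_eq_iff)

text \<open>For \<open>n = 1\<close> the list length is 0: the only simplex is the empty one and no
  cycle condition is imposed.\<close>

lemma steinberg_eq:
  "steinberg R n = {c. (\<forall>F. F \<notin> simplices R n (n - 1) \<longrightarrow> c F = 0) \<and>
     (n - 1 = 0 \<or> bdry (simplices R n) (n - 1) c = (\<lambda>H. 0))}"
  by (auto simp: steinberg_def top_cycles_def chains_def boundary_eq_bdry)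

theorem theoremF:
  fixes R :: "('a, 'm) ring_scheme" and I :: "'a set" and n :: nat
  assumes "cring R" and "finite (carrier R)"
    and "ideal I R" and "I \<subseteq> jacobson_radical R"
    and "n \<ge> 1"
  shows "bij_betw (st_map R I n)
           (invariants R n (congruence_subgroup R I n) (steinberg R n :: ((nat \<Rightarrow> 'a) set list \<Rightarrow> 'k::field_char_0) set))
           (steinberg (R Quot I) n)
       \<and> (\<forall>g\<in>GL R n. \<forall>c\<in>(steinberg R n :: ((nat \<Rightarrow> 'a) set list \<Rightarrow> 'k) set).
            st_map R I n (act_st R n g c) = act_st (R Quot I) n (red_mat R I g) (st_map R I n c))"
proof -
  interpret cring R by fact
  interpret radical_quotient R I 
    by (intro radical_quotient.intro finite_cring.intro finite_cring_axioms.intro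
      radical_quotient_axioms.intro assms)
  note n = \<open>n \<ge> 1\<close>
  let ?X = "simplices R n" and ?Y = "simplices (R Quot I) n" and ?G = "congruence_subgroup R I n"
  \<comment> \<open>The abstract family of maps is the image of the congruence subgroup under
    \<open>act_flag\<close>; its orbits are the fibres by \<open>red_flag_eq_iff\<close>.\<close>
  have "bij_betw (push (?X (n - 1)) (red_flag R I) (?Y (n - 1)))
    {c :: _ \<Rightarrow> 'k. (\<forall>F. F \<notin> ?X (n - 1) \<longrightarrow> c F = 0) \<and> (n - 1 = 0 \<or> bdry ?X (n - 1) c = (\<lambda>H. 0))
       \<and> (\<forall>a\<in>act_flag R n ` ?G. push (?X (n - 1)) a (?X (n - 1)) c = c)}
    {z. (\<forall>F. F \<notin> ?Y (n - 1) \<longrightarrow> z F = 0) \<and> (n - 1 = 0 \<or> bdry ?Y (n - 1) z = (\<lambda>H. 0))}"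
  proof (rule push_bij_betw_invariant_cycles)
    show "red_flag R I ` ?X l = ?Y l" for l by (rule red_flag_image[OF n])
    show "del_at i F \<in> ?X (l - 1)" if "i < l" "F \<in> ?X l" for l i F using that by (rule del_at_simplices)
    show "del_at i F \<in> ?Y (l - 1)" if "i < l" "F \<in> ?Y l" for l i F using that by (rule del_at_simplices)
    show "bij_betw a (?X l) (?X l)" if "a \<in> act_flag R n ` ?G" for l a
      using that bij_betw_act_flag[OF n] congruence_subgroup_iff by blast
    show "red_flag R I F' = red_flag R I F \<longleftrightarrow> (\<exists>a\<in>act_flag R n ` ?G. F' = a F)"
      if "F \<in> ?X l" "F' \<in> ?X l" for l F F'
      using red_flag_eq_iff[OF n that] by simp
  qed (auto simp: finite_simplices Q.finite_simplices red_flag_def act_flag_def map_del_at)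
  moreover have "invariants R n ?G (steinberg R n :: (_ \<Rightarrow> 'k) set)
    = {c. (\<forall>F. F \<notin> ?X (n - 1) \<longrightarrow> c F = 0) \<and> (n - 1 = 0 \<or> bdry ?X (n - 1) c = (\<lambda>H. 0))
       \<and> (\<forall>a\<in>act_flag R n ` ?G. push (?X (n - 1)) a (?X (n - 1)) c = c)}"
    by (simp add: invariants_def steinberg_eq act_st_eq_push conj_assoc)
  ultimately have "bij_betw (st_map R I n) (invariants R n ?G (steinberg R n :: (_ \<Rightarrow> 'k) set)) (steinberg (R Quot I) n)"
    by (simp only: st_map_eq_push steinberg_eq)
  moreover have "st_map R I n (act_st R n g c) = act_st (R Quot I) n (red_mat R I g) (st_map R I n c)"
    if g: "g \<in> GL R n" for g and c :: "_ \<Rightarrow> 'k"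
  proof -
    \<comment> \<open>Equivariance already holds on flags: reducing after acting by \<open>g\<close>
      is acting by \<open>red_mat R I g\<close> after reducing.\<close>
    have "push (?X (n - 1)) (red_flag R I) (?Y (n - 1)) (push (?X (n - 1)) (act_flag R n g) (?X (n - 1)) c)
        = push (?X (n - 1)) (red_flag R I \<circ> act_flag R n g) (?Y (n - 1)) c"
      by (rule push_push) (use finite_simplices act_flag_simplices[OF n g] in auto)
    also have "\<dots> = push (?X (n - 1)) (act_flag (R Quot I) n (red_mat R I g) \<circ> red_flag R I) (?Y (n - 1)) c"
      by (rule push_cong) (use red_flag_act_flag[OF GL_mats[OF g] simplices_subset_vecs] in auto)
    also have "\<dots> = push (?Y (n - 1)) (act_flag (R Quot I) n (red_mat R I g)) (?Y (n - 1))
        (push (?X (n - 1)) (red_flag R I) (?Y (n - 1)) c)"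
      by (rule push_push[symmetric]) (use finite_simplices Q.finite_simplices red_flag_image[OF n] in auto)
    finally show ?thesis by (simp add: st_map_eq_push act_st_eq_push)
  qed
  ultimately show ?thesis by blast
qed

end
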